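(* There exists an absolute constant $\kappa>1/100$ such that the following holds. Let $b\ge2$, $\theta=1/\sqrt b$, $\beta_c=\operatorname{arctanh}\theta$, let $0<\alpha<1/2$ and $h$ be such that $\ell=\alpha h$ is a positive integer, and put $r=h-\ell$. For any boundary condition $\tau$ on the leaves of the $b$-ary tree of height $h$, the spectral gap of the block dynamics with blocks $\mathcal B$ (defined below) for the Ising model at inverse temperature $\beta_c$ satisfies $$\mathrm{gap}^\tau_{\mathcal B}\ge\frac1{4(b^\ell+1)}\Big(1-\frac{\alpha}{\kappa(1-\theta)(1-2\alpha)}\Big).$$
   Context: The $b$-ary tree of height $h$ is the rooted tree with root $\rho$ in which every vertex at distance less than $h$ from $\rho$ has exactly $b$ children; $H_k$ is the set of vertices at distance $k$ from $\rho$, and the leaves $H_h$ carry the boundary condition $\tau$. The Ising Gibbs measure $\mu^\tau$ has density $\propto\exp(\beta\sum_{uv}\sigma(u)\sigma(v))$ conditioned on agreeing with $\tau$ on the leaves. For a vertex $v$ and $k\ge1$, $B(v,k)$ is the set of descendants $u$ of $v$ (including $v$) with $\mathrm{dist}(v,u)\le k-1$. The blocks are $\mathcal B=\{B(v,r):v\in H_\ell\cup\{\rho\}\}$ ($b^\ell+1$ blocks, covering all non-leaf vertices). The (discrete-time) block dynamics: at each step one block is chosen uniformly at random and all its spins are resampled jointly from $\mu^\tau$ conditioned on all spins outside the block. $\mathrm{gap}$ denotes $1-\lambda$, $\lambda$ the largest nontrivial eigenvalue. *)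

theory Defs
  imports Complex_Main
begin

type_synonym vertex = "nat list"   (* root = [], children of v are v @ [i], i < b *)
type_synonym config = "vertex \<Rightarrow> int"

definition tree_V :: "nat \<Rightarrow> nat \<Rightarrow> vertex set" where
  "tree_V b h = {v. length v \<le> h \<and> set v \<subseteq> {..<b}}"

definition level :: "nat \<Rightarrow> nat \<Rightarrow> nat \<Rightarrow> vertex set" where
  "level b h k = {v \<in> tree_V b h. length v = k}"

definition block :: "nat \<Rightarrow> nat \<Rightarrow> vertex \<Rightarrow> nat \<Rightarrow> vertex set" where
  "block b h v k = {u \<in> tree_V b h. \<exists>w. u = v @ w \<and> length w + 1 \<le> k}"

definition configs :: "nat \<Rightarrow> nat \<Rightarrow> config \<Rightarrow> config set" where
  "configs b h \<tau> = {\<sigma>. (\<forall>v \<in> tree_V b h. \<sigma> v \<in> {-1, 1})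
                      \<and> (\<forall>v. v \<notin> tree_V b h \<longrightarrow> \<sigma> v = 0)
                      \<and> (\<forall>v \<in> level b h h. \<sigma> v = \<tau> v)}"

text \<open>Sum over edges {u, parent u} of sigma(u) sigma(parent u).\<close>
definition ising_energy :: "nat \<Rightarrow> nat \<Rightarrow> config \<Rightarrow> real" where
  "ising_energy b h \<sigma> = (\<Sum>u \<in> tree_V b h - {[]}. real_of_int (\<sigma> u * \<sigma> (butlast u)))"

definition ising_weight :: "nat \<Rightarrow> nat \<Rightarrow> real \<Rightarrow> config \<Rightarrow> real" where
  "ising_weight b h \<beta> \<sigma> = exp (\<beta> * ising_energy b h \<sigma>)"

definition gibbs :: "nat \<Rightarrow> nat \<Rightarrow> real \<Rightarrow> config \<Rightarrow> config \<Rightarrow> real" where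
  "gibbs b h \<beta> \<tau> \<sigma> = ising_weight b h \<beta> \<sigma> / (\<Sum>\<eta> \<in> configs b h \<tau>. ising_weight b h \<beta> \<eta>)"

definition block_update :: "nat \<Rightarrow> nat \<Rightarrow> real \<Rightarrow> config \<Rightarrow> vertex set \<Rightarrow> config \<Rightarrow> config \<Rightarrow> real" where
  "block_update b h \<beta> \<tau> B \<sigma> \<eta> =
     (if \<eta> \<in> configs b h \<tau> \<and> (\<forall>u. u \<notin> B \<longrightarrow> \<eta> u = \<sigma> u)
      then gibbs b h \<beta> \<tau> \<eta> /
           (\<Sum>\<zeta> \<in> {\<zeta> \<in> configs b h \<tau>. \<forall>u. u \<notin> B \<longrightarrow> \<zeta> u = \<sigma> u}. gibbs b h \<beta> \<tau> \<zeta>)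
      else 0)"

definition block_dynamics :: "nat \<Rightarrow> nat \<Rightarrow> real \<Rightarrow> config \<Rightarrow> nat \<Rightarrow> nat \<Rightarrow> config \<Rightarrow> config \<Rightarrow> real" where
  "block_dynamics b h \<beta> \<tau> l r \<sigma> \<eta> =
     (\<Sum>v \<in> level b h l \<union> {[]}. block_update b h \<beta> \<tau> (block b h v r) \<sigma> \<eta>)
       / real (card (level b h l \<union> {[]}))"

text \<open>Generic: a transition kernel P on a finite state space S with stationary
  distribution pi; nontrivial eigenvalues are those having an eigenfunction that is
  nonzero and orthogonal to the constants in L^2(pi).\<close>
definition nontrivial_eigenvalues :: "'s set \<Rightarrow> ('s \<Rightarrow> real) \<Rightarrow> ('s \<Rightarrow> 's \<Rightarrow> real) \<Rightarrow> real set" where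
  "nontrivial_eigenvalues S \<pi> P =
     {c. \<exists>f :: 's \<Rightarrow> real. (\<exists>x \<in> S. f x \<noteq> 0) \<and> (\<Sum>x \<in> S. \<pi> x * f x) = 0
          \<and> (\<forall>x \<in> S. (\<Sum>y \<in> S. P x y * f y) = c * f x)}"

definition spectral_gap :: "'s set \<Rightarrow> ('s \<Rightarrow> real) \<Rightarrow> ('s \<Rightarrow> 's \<Rightarrow> real) \<Rightarrow> real" where
  "spectral_gap S \<pi> P = 1 - Sup (nontrivial_eigenvalues S \<pi> P)"

definition block_gap :: "nat \<Rightarrow> nat \<Rightarrow> real \<Rightarrow> config \<Rightarrow> nat \<Rightarrow> nat \<Rightarrow> real" where
  "block_gap b h \<beta> \<tau> l r =
     spectral_gap (configs b h \<tau>) (gibbs b h \<beta> \<tau>) (block_dynamics b h \<beta> \<tau> l r)"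

end

theory Submission
  imports Defs "HOL-Analysis.Convex"
begin

text \<open>
  Let \<open>E S\<close> denote the conditional expectation that resamples the spins in \<open>S\<close>. By Efron-Stein for the
  conditionally independent subtrees rooted at level \<open>l\<close>, the Dirichlet form of the block dynamics
  dominates, up to the number of blocks, \<open>Var(f | levels < l) + Var(f | levels \<ge> r)\<close>, and this sum controls
  \<open>Var f\<close> as soon as the squared maximal correlation between the levels \<open>< l\<close> and the levels \<open>\<ge> r\<close>
  is less than one.

  Revealing the top levels one at a time and tensorizing over the subtrees of each level, this squared
  correlation is at most the sum over the \<open>l\<close> top levels of the squared correlation between a single spin and
  the observed part of its own subtree. For any prior bias of that spin, the latter is at most
  twice the Hellinger defect \<open>1 - \<Sum> sqrt (P\<^sub>+ P\<^sub>-)\<close> of the two conditional laws of the observation. Along an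
  edge with an arbitrary external field the defect contracts by \<open>(tanh \<beta>)\<^sup>2 = 1/b\<close>, and affinities multiply over
  the \<open>b\<close> children, so a defect \<open>d\<close> of the children becomes at most \<open>1 - (1 - d/b)^b \<le> d - d\<^sup>2/4\<close>. Hence the
  defect at height \<open>n\<close> above the observed level is \<open>O(1/n)\<close>, and the squared correlation is at most
  \<open>8 l / (r - l)\<close>, which gives the theorem with \<open>\<kappa> = 1/8\<close>.
\<close>

section \<open>Real inequalities\<close>

text \<open>With \<open>x = d / b\<close> this bounds the \<open>b\<close>-fold product over
  children below by \<open>1 - d + d^2 / 4\<close>, uniformly in \<open>b\<close>. There is equality
  at \<open>b = 2\<close>; in the inductive step the surplus is
  \<open>x * (z * (1 - z) - x / 4)\<close>, nonnegative because
  \<open>x \<le> 2 * z \<le> 1\<close>.\<close>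

lemma one_minus_power_ge_square:
  fixes x :: real
  assumes "2 \<le> b" "0 \<le> x" "real b * x \<le> 1"
  shows "(1 - real b * x / 2)\<^sup>2 \<le> (1 - x) ^ b"
  using assms
proof (induction b rule: nat_induct_at_least)
  case base
  then show ?case by (simp add: power2_eq_square)
next
  case (Suc n)
  define z where "z = real n * x / 2"
  have x: "0 \<le> x" "x \<le> 2 * z" "2 * z + x \<le> 1"
    using Suc.hyps Suc.prems mult_right_mono[of 1 "real n" x]
    by (auto simp: z_def algebra_simps)
  have IH: "(1 - z)\<^sup>2 \<le> (1 - x) ^ n"
    using Suc.IH Suc.prems by (simp add: z_def algebra_simps)
  have "0 \<le> z * (1 - 2 * z)" using x by (intro mult_nonneg_nonneg) auto
  then have "x / 4 \<le> z * (1 - z)" using x(2) by (simp add: algebra_simps)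
  then have "0 \<le> x * (z * (1 - z) - x / 4)" using x by (intro mult_nonneg_nonneg) auto
  then have "(1 - z - x / 2)\<^sup>2 \<le> (1 - z)\<^sup>2 * (1 - x)"
    by (simp add: power2_eq_square algebra_simps)
  also have "\<dots> \<le> (1 - x) ^ n * (1 - x)"
    using IH x by (intro mult_right_mono) auto
  finally have "(1 - z - x / 2)\<^sup>2 \<le> (1 - x) ^ n * (1 - x)" .
  moreover have "1 - z - x / 2 = 1 - real (Suc n) * x / 2"
    by (simp add: z_def distrib_right add_divide_distrib)
  ultimately show ?case by (simp only: power_Suc2)
qed

text \<open>\<open>P\<close> and \<open>Q\<close> are the laws of an observation under the two
  values of a hidden bit with prior \<open>(p, q)\<close>; \<open>c\<close> bounds the squared
  correlation whatever the prior. The conditional mean given the bit has variance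
  \<open>p * q * (a - d)^2\<close>, and Cauchy-Schwarz is applied after splitting
  \<open>P - Q\<close> as \<open>(sqrt P - sqrt Q) * (sqrt P + sqrt Q)\<close>.\<close>

lemma two_point_variance:
  fixes P Q g :: "'y \<Rightarrow> real"
  assumes Y: "finite Y" and P: "\<And>y. y \<in> Y \<Longrightarrow> 0 \<le> P y" and Q: "\<And>y. y \<in> Y \<Longrightarrow> 0 \<le> Q y"
    and sumP: "sum P Y = 1" and sumQ: "sum Q Y = 1"
    and pq: "0 \<le> p" "0 \<le> q" "p + q = 1"
    and c: "(\<Sum>y\<in>Y. (sqrt (P y) - sqrt (Q y))\<^sup>2) \<le> c"
  defines "a \<equiv> (\<Sum>y\<in>Y. P y * g y)" and "d \<equiv> (\<Sum>y\<in>Y. Q y * g y)"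
  shows "p * a\<^sup>2 + q * d\<^sup>2 \<le>
    c * (p * (\<Sum>y\<in>Y. P y * (g y)\<^sup>2) + q * (\<Sum>y\<in>Y. Q y * (g y)\<^sup>2)) + (1 - c) * (p * a + q * d)\<^sup>2"
proof -
  define m where "m = p * a + q * d"
  define V where "V = (\<Sum>y\<in>Y. (p * P y + q * Q y) * (g y - m)\<^sup>2)"
  have V: "V = p * (\<Sum>y\<in>Y. P y * (g y)\<^sup>2) + q * (\<Sum>y\<in>Y. Q y * (g y)\<^sup>2) - m\<^sup>2"
  proof -
    have "V = (\<Sum>y\<in>Y. p * (P y * (g y)\<^sup>2) + q * (Q y * (g y)\<^sup>2)
        - 2 * m * (p * (P y * g y) + q * (Q y * g y)) + m\<^sup>2 * (p * P y + q * Q y))"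
      unfolding V_def by (intro sum.cong refl) (simp add: power2_eq_square algebra_simps)
    also have "\<dots> = p * (\<Sum>y\<in>Y. P y * (g y)\<^sup>2) + q * (\<Sum>y\<in>Y. Q y * (g y)\<^sup>2)
        - 2 * m * (p * a + q * d) + m\<^sup>2 * (p * sum P Y + q * sum Q Y)"
      by (simp add: sum.distrib sum_subtractf a_def d_def flip: sum_distrib_left)
    also have "\<dots> = p * (\<Sum>y\<in>Y. P y * (g y)\<^sup>2) + q * (\<Sum>y\<in>Y. Q y * (g y)\<^sup>2) - m\<^sup>2"
      using pq by (simp add: sumP sumQ flip: m_def) (simp add: power2_eq_square)
    finally show ?thesis .
  qed
  have diff: "a - d = (\<Sum>y\<in>Y. (sqrt (P y) - sqrt (Q y)) * ((sqrt (P y) + sqrt (Q y)) * (g y - m)))"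
  proof -
    have "(\<Sum>y\<in>Y. (sqrt (P y) - sqrt (Q y)) * ((sqrt (P y) + sqrt (Q y)) * (g y - m)))
        = (\<Sum>y\<in>Y. P y * g y - Q y * g y - m * (P y - Q y))"
    proof (intro sum.cong refl)
      fix y assume "y \<in> Y"
      then have "(sqrt (P y) - sqrt (Q y)) * (sqrt (P y) + sqrt (Q y)) = P y - Q y"
        using P Q by (simp add: algebra_simps)
      then show "(sqrt (P y) - sqrt (Q y)) * ((sqrt (P y) + sqrt (Q y)) * (g y - m)) =
          P y * g y - Q y * g y - m * (P y - Q y)"
        by (simp only: mult.assoc[symmetric]) (simp add: algebra_simps)
    qed
    then show ?thesis
      by (simp add: sum_subtractf a_def d_def sumP sumQ flip: sum_distrib_left)
  qed
  have "p * q * (a - d)\<^sup>2 \<le> p * q * ((\<Sum>y\<in>Y. (sqrt (P y) - sqrt (Q y))\<^sup>2) *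
      (\<Sum>y\<in>Y. ((sqrt (P y) + sqrt (Q y)) * (g y - m))\<^sup>2))"
    unfolding diff using pq by (intro mult_left_mono Cauchy_Schwarz_ineq_sum) auto
  also have "\<dots> = (\<Sum>y\<in>Y. (sqrt (P y) - sqrt (Q y))\<^sup>2) *
      (\<Sum>y\<in>Y. (p * q * (sqrt (P y) + sqrt (Q y))\<^sup>2) * (g y - m)\<^sup>2)"
    by (simp add: sum_distrib_left power_mult_distrib mult_ac)
  also have "\<dots> \<le> c * V"
    unfolding V_def
  proof (intro mult_mono c sum_mono mult_right_mono sum_nonneg)
    fix y assume y: "y \<in> Y"
    \<comment> \<open>As \<open>p + q = 1\<close>, this square is exactly the gap between the two
      sides; the prior drops out here.\<close>
    have "0 \<le> (p * sqrt (P y) - q * sqrt (Q y))\<^sup>2" by simp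
    moreover have "q = 1 - p" using pq by simp
    moreover have "(sqrt (P y))\<^sup>2 = P y" "(sqrt (Q y))\<^sup>2 = Q y" using P[OF y] Q[OF y] by simp_all
    ultimately show "p * q * (sqrt (P y) + sqrt (Q y))\<^sup>2 \<le> p * P y + q * Q y"
      by (simp add: power2_sum power2_diff power_mult_distrib) (simp add: power2_eq_square algebra_simps)
  next
    show "0 \<le> c" using c by (meson order_trans sum_nonneg zero_le_power2)
  qed (use pq P Q in auto)
  finally have "p * q * (a - d)\<^sup>2 \<le> c * V" .
  moreover have "p * a\<^sup>2 + q * d\<^sup>2 = p * q * (a - d)\<^sup>2 + m\<^sup>2"
  proof -
    have q: "q = 1 - p" using pq(3) by simp
    show ?thesis unfolding m_def q by (simp add: power2_eq_square algebra_simps)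
  qed
  ultimately show ?thesis unfolding V m_def by argo
qed

text \<open>
  The channel with rows \<open>(p, 1 - p)\<close> and \<open>(p', 1 - p')\<close> is an Ising edge \<open>k = exp (2 \<beta>)\<close> seen through an
  arbitrary field. With \<open>A = sqrt (p (1 - p'))\<close> and \<open>B = sqrt (p' (1 - p))\<close>, Cauchy-Schwarz gives
  \<open>sqrt u + sqrt t \<ge> (A + B) (sqrt a + sqrt c)\<close> for the two mixtures, while
  \<open>u - t = (A - B) (A + B) (a - c)\<close> and \<open>A + B \<le> 1\<close>.
\<close>

lemma sqrt_mixture_contraction:
  fixes a c k :: real
  assumes ac: "0 \<le> a" "0 \<le> c"
    and p: "0 \<le> p" "p \<le> 1" "0 \<le> p'" "p' \<le> 1"
    and odds: "p * (1 - p') = k\<^sup>2 * (p' * (1 - p))" and k: "1 \<le> k"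
  shows "(sqrt (p * a + (1 - p) * c) - sqrt (p' * a + (1 - p') * c))\<^sup>2
    \<le> ((k - 1) / (k + 1))\<^sup>2 * (sqrt a - sqrt c)\<^sup>2"
proof -
  define u where "u = sqrt (p * a + (1 - p) * c)"
  define t where "t = sqrt (p' * a + (1 - p') * c)"
  define A where "A = sqrt (p * (1 - p'))"
  define B where "B = sqrt (p' * (1 - p))"
  have AB: "A = k * B" "0 \<le> B" "0 \<le> A" using p k
    by (auto simp: A_def B_def odds real_sqrt_mult)
  have ut: "0 \<le> u" "0 \<le> t" using p ac by (auto simp: u_def t_def)
  \<comment> \<open>Cauchy-Schwarz against the distribution \<open>(x2, 1 - x2)\<close>. Taking for
    it the other row with its entries exchanged makes the coefficients equal to \<open>A\<close> and
    \<open>B\<close>.\<close>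
  have CS: "sqrt x1 * sqrt x2 * sqrt y1 + sqrt (1 - x1) * sqrt (1 - x2) * sqrt y2
      \<le> sqrt (x1 * y1 + (1 - x1) * y2)"
    if "0 \<le> x1" "x1 \<le> 1" "0 \<le> x2" "x2 \<le> 1" "0 \<le> y1" "0 \<le> y2" for x1 x2 y1 y2 :: real
  proof (rule real_le_rsqrt)
    have "0 \<le> (sqrt x1 * sqrt y1 * sqrt (1 - x2) - sqrt (1 - x1) * sqrt y2 * sqrt x2)\<^sup>2" by simp
    then show "(sqrt x1 * sqrt x2 * sqrt y1 + sqrt (1 - x1) * sqrt (1 - x2) * sqrt y2)\<^sup>2
        \<le> x1 * y1 + (1 - x1) * y2"
      using that by (simp add: power2_sum power2_diff power_mult_distrib algebra_simps)
  qed
  have "A + B \<le> 1"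
    using CS[of p "1 - p'" 1 1] p by (simp add: A_def B_def real_sqrt_mult mult.commute)
  have "A * sqrt a + B * sqrt c \<le> u"
    using CS[of p "1 - p'" a c] p ac by (simp add: A_def B_def u_def real_sqrt_mult mult_ac)
  moreover have "B * sqrt a + A * sqrt c \<le> t"
    using CS[of p' "1 - p" a c] p ac by (simp add: A_def B_def t_def real_sqrt_mult mult_ac)
  ultimately have sum: "(A + B) * (sqrt a + sqrt c) \<le> u + t" by (simp add: algebra_simps)
  have "u\<^sup>2 = p * a + (1 - p) * c" "t\<^sup>2 = p' * a + (1 - p') * c"
    using p ac by (simp_all add: u_def t_def)
  then have "(u - t) * (u + t) = (p - p') * (a - c)"
    by (simp add: algebra_simps power2_eq_square)
  also have "p - p' = (A - B) * (A + B)"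
  proof -
    have "A\<^sup>2 = p * (1 - p')" "B\<^sup>2 = p' * (1 - p)" using p by (simp_all add: A_def B_def)
    then show ?thesis by (simp add: algebra_simps power2_eq_square)
  qed
  also have "a - c = (sqrt a - sqrt c) * (sqrt a + sqrt c)"
    using ac by (simp add: algebra_simps)
  finally have prod: "(u - t) * (u + t) = (A - B) * (sqrt a - sqrt c) * ((A + B) * (sqrt a + sqrt c))"
    by (simp add: mult_ac)
  have "\<bar>u - t\<bar> \<le> \<bar>A - B\<bar> * \<bar>sqrt a - sqrt c\<bar>"
  proof (cases "u + t = 0")
    case True
    then have "u = 0" "t = 0" using ut by auto
    then show ?thesis by simp
  next
    case False
    then have pos: "0 < u + t" using ut by simp
    have "\<bar>u - t\<bar> * (u + t) = \<bar>(u - t) * (u + t)\<bar>" using pos by (simp add: abs_mult)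
    also have "\<dots> = \<bar>A - B\<bar> * \<bar>sqrt a - sqrt c\<bar> * ((A + B) * (sqrt a + sqrt c))"
      unfolding prod using AB ac by (simp add: abs_mult)
    also have "\<dots> \<le> \<bar>A - B\<bar> * \<bar>sqrt a - sqrt c\<bar> * (u + t)"
      by (intro mult_left_mono sum) simp
    finally show ?thesis using pos by (simp add: mult_le_cancel_right)
  qed
  moreover have "\<bar>A - B\<bar> \<le> (k - 1) / (k + 1)"
  proof -
    \<comment> \<open>Since \<open>A = k * B\<close>, difference and sum of \<open>A\<close> and
      \<open>B\<close> are in the ratio \<open>(k - 1) / (k + 1)\<close>, which is
      \<open>tanh \<beta>\<close> for \<open>k = exp (2 * \<beta>)\<close>.\<close>
    have "A - B = (k - 1) / (k + 1) * (A + B)" using AB k by (simp add: field_simps)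
    moreover have "0 \<le> A - B" using AB k by (simp add: mult_right_mono[of 1 k B, simplified])
    moreover have "(k - 1) / (k + 1) * (A + B) \<le> (k - 1) / (k + 1) * 1"
      using \<open>A + B \<le> 1\<close> k by (intro mult_left_mono) auto
    ultimately show ?thesis by linarith
  qed
  ultimately have "\<bar>u - t\<bar> \<le> (k - 1) / (k + 1) * \<bar>sqrt a - sqrt c\<bar>"
    by (meson mult_right_mono abs_ge_zero order_trans)
  then have "\<bar>u - t\<bar>\<^sup>2 \<le> ((k - 1) / (k + 1) * \<bar>sqrt a - sqrt c\<bar>)\<^sup>2" by (intro power_mono) auto
  then show ?thesis unfolding u_def t_def power_mult_distrib power2_abs .
qed

lemma sum_hellinger:
  assumes "\<And>y. y \<in> Y \<Longrightarrow> 0 \<le> P y" "\<And>y. y \<in> Y \<Longrightarrow> 0 \<le> Q y"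
    and "sum P Y = 1" "sum Q Y = (1::real)"
  shows "(\<Sum>y\<in>Y. (sqrt (P y) - sqrt (Q y))\<^sup>2) = 2 * (1 - (\<Sum>y\<in>Y. sqrt (P y * Q y)))"
proof -
  have "(\<Sum>y\<in>Y. (sqrt (P y) - sqrt (Q y))\<^sup>2) = (\<Sum>y\<in>Y. P y + Q y - 2 * sqrt (P y * Q y))"
    using assms by (intro sum.cong refl) (simp add: power2_diff real_sqrt_mult)
  then show ?thesis using assms by (simp add: sum.distrib sum_subtractf flip: sum_distrib_left)
qed

text \<open>\<open>sqrt_mixture_contraction\<close> is summed over the observations, and both
  Hellinger sums are rewritten through affinities, each with the same factor 2. This is the
  contraction of the defect along one edge.\<close>

lemma affinity_mixture:
  fixes k :: real
  assumes P: "\<And>y. y \<in> Y \<Longrightarrow> 0 \<le> P y" and Q: "\<And>y. y \<in> Y \<Longrightarrow> 0 \<le> Q y"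
    and sumP: "sum P Y = 1" and sumQ: "sum Q Y = 1"
    and p: "0 \<le> p" "p \<le> 1" "0 \<le> p'" "p' \<le> 1"
    and odds: "p * (1 - p') = k\<^sup>2 * (p' * (1 - p))" and k: "1 \<le> k"
  shows "1 - ((k - 1) / (k + 1))\<^sup>2 * (1 - (\<Sum>y\<in>Y. sqrt (P y * Q y)))
    \<le> (\<Sum>y\<in>Y. sqrt ((p * P y + (1 - p) * Q y) * (p' * P y + (1 - p') * Q y)))"
proof -
  define e where "e = ((k - 1) / (k + 1))\<^sup>2"
  have "(\<Sum>y\<in>Y. (sqrt (p * P y + (1 - p) * Q y) - sqrt (p' * P y + (1 - p') * Q y))\<^sup>2)
      \<le> (\<Sum>y\<in>Y. e * (sqrt (P y) - sqrt (Q y))\<^sup>2)"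
    unfolding e_def by (rule sum_mono) (rule sqrt_mixture_contraction[OF P Q p odds k])
  also have "\<dots> = e * (\<Sum>y\<in>Y. (sqrt (P y) - sqrt (Q y))\<^sup>2)" by (rule sum_distrib_left[symmetric])
  also have "(\<Sum>y\<in>Y. (sqrt (P y) - sqrt (Q y))\<^sup>2) = 2 * (1 - (\<Sum>y\<in>Y. sqrt (P y * Q y)))"
    by (rule sum_hellinger[OF P Q sumP sumQ])
  also have "(\<Sum>y\<in>Y. (sqrt (p * P y + (1 - p) * Q y) - sqrt (p' * P y + (1 - p') * Q y))\<^sup>2)
     = 2 * (1 - (\<Sum>y\<in>Y. sqrt ((p * P y + (1 - p) * Q y) * (p' * P y + (1 - p') * Q y))))"
    using P Q p by (intro sum_hellinger) (simp_all add: sum.distrib sumP sumQ flip: sum_distrib_left)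
  finally show ?thesis unfolding e_def[symmetric] by (simp add: algebra_simps)
qed

lemma sqrt_prod_mult:
  fixes f g :: "'i \<Rightarrow> real"
  shows "sqrt ((\<Prod>i\<in>I. f i) * (\<Prod>i\<in>I. g i)) = (\<Prod>i\<in>I. sqrt (f i * g i))"
  by (induction I rule: infinite_finite_induct) (simp_all add: real_sqrt_mult mult_ac)

lemma tanh_exp_double: "tanh x = (exp (2 * x) - 1) / (exp (2 * x) + 1)" for x :: real
  by (simp add: tanh_altdef exp_minus exp_double divide_simps power2_eq_square
      add_pos_pos[THEN less_imp_neq, symmetric])

lemma tanh_artanh_real:
  fixes x :: real
  assumes "\<bar>x\<bar> < 1"
  shows "tanh (artanh x) = x"
proof -
  have e: "exp (2 * artanh x) = (1 + x) / (1 - x)"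
    using assms by (simp add: artanh_def)
  have "1 - x \<noteq> 0" using assms by auto
  then have "(1 + x) / (1 - x) - 1 = 2 * x / (1 - x)" "(1 + x) / (1 - x) + 1 = 2 / (1 - x)"
    by (simp_all add: divide_simps)
  then show ?thesis unfolding tanh_exp_double e using \<open>1 - x \<noteq> 0\<close> by simp
qed

section \<open>Resampling operators of a finite spin system\<close>

text \<open>\<open>W\<close> is left unnormalised, since conditional expectations and ratios of
  norms do not see the constant. \<open>mix_closed\<close> makes \<open>\<Omega>\<close> a product
  set: frozen spins are allowed, hard constraints between spins are not.\<close>

locale spin_system =
  fixes \<Omega> :: "('v \<Rightarrow> 's) set" and W :: "('v \<Rightarrow> 's) \<Rightarrow> real"
  assumes finite_\<Omega>: "finite \<Omega>"
    and W_pos: "\<sigma> \<in> \<Omega> \<Longrightarrow> 0 < W \<sigma>"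
    and mix_closed: "\<sigma> \<in> \<Omega> \<Longrightarrow> \<eta> \<in> \<Omega> \<Longrightarrow> (\<lambda>u. if u \<in> S then \<eta> u else \<sigma> u) \<in> \<Omega>"
begin

definition fib :: "'v set \<Rightarrow> ('v \<Rightarrow> 's) \<Rightarrow> ('v \<Rightarrow> 's) set" where
  "fib S \<sigma> = {\<eta> \<in> \<Omega>. \<forall>u. u \<notin> S \<longrightarrow> \<eta> u = \<sigma> u}"

definition mass :: "'v set \<Rightarrow> ('v \<Rightarrow> 's) \<Rightarrow> real" where
  "mass S \<sigma> = sum W (fib S \<sigma>)"

text \<open>\<open>E S f \<sigma>\<close> is the conditional expectation of \<open>f\<close> given the spins of \<open>\<sigma>\<close> outside \<open>S\<close>.\<close>

definition E :: "'v set \<Rightarrow> (('v \<Rightarrow> 's) \<Rightarrow> real) \<Rightarrow> ('v \<Rightarrow> 's) \<Rightarrow> real" where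
  "E S f \<sigma> = (\<Sum>\<eta>\<in>fib S \<sigma>. W \<eta> * f \<eta>) / mass S \<sigma>"

definition ip :: "(('v \<Rightarrow> 's) \<Rightarrow> real) \<Rightarrow> (('v \<Rightarrow> 's) \<Rightarrow> real) \<Rightarrow> real" where
  "ip f g = (\<Sum>\<sigma>\<in>\<Omega>. W \<sigma> * f \<sigma> * g \<sigma>)"

abbreviation nrm2 :: "(('v \<Rightarrow> 's) \<Rightarrow> real) \<Rightarrow> real" where
  "nrm2 f \<equiv> ip f f"

text \<open>Measurability with respect to the spins outside \<open>S\<close>. \<open>E S\<close> is
  the orthogonal projection of \<open>L^2(W)\<close> onto these functions.\<close>

definition ignores :: "'v set \<Rightarrow> (('v \<Rightarrow> 's) \<Rightarrow> 'c) \<Rightarrow> bool" where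
  "ignores S f \<longleftrightarrow> (\<forall>\<sigma>\<in>\<Omega>. \<forall>\<eta>\<in>fib S \<sigma>. f \<eta> = f \<sigma>)"

section \<open>Conditional expectations as orthogonal projections\<close>

lemma ignoresD: "ignores S f \<Longrightarrow> \<sigma> \<in> \<Omega> \<Longrightarrow> \<eta> \<in> fib S \<sigma> \<Longrightarrow> f \<eta> = f \<sigma>"
  by (auto simp: ignores_def)

lemma fib_subset: "fib S \<sigma> \<subseteq> \<Omega>"
  by (auto simp: fib_def)

lemma fib_in: "\<eta> \<in> fib S \<sigma> \<Longrightarrow> \<eta> \<in> \<Omega>"
  by (auto simp: fib_def)

lemma finite_fib [simp]: "finite (fib S \<sigma>)"
  using finite_\<Omega> fib_subset finite_subset by blast

lemma fib_refl: "\<sigma> \<in> \<Omega> \<Longrightarrow> \<sigma> \<in> fib S \<sigma>"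
  by (auto simp: fib_def)

lemma fib_eq: "\<eta> \<in> fib S \<sigma> \<Longrightarrow> fib S \<eta> = fib S \<sigma>"
  by (auto simp: fib_def)

lemma fib_sym: "\<sigma> \<in> \<Omega> \<Longrightarrow> \<eta> \<in> fib S \<sigma> \<Longrightarrow> \<sigma> \<in> fib S \<eta>"
  by (auto simp: fib_def)

lemma fib_mono: "S \<subseteq> T \<Longrightarrow> fib S \<sigma> \<subseteq> fib T \<sigma>"
  by (auto simp: fib_def)

lemma ignores_mono: "ignores T f \<Longrightarrow> S \<subseteq> T \<Longrightarrow> ignores S f"
  unfolding ignores_def using fib_mono[of S T] by (metis subsetD)

lemma mass_pos: "\<sigma> \<in> \<Omega> \<Longrightarrow> 0 < mass S \<sigma>"
  unfolding mass_def by (intro sum_pos finite_fib) (use fib_refl fib_in W_pos in blast)+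

lemma E_cong: "(\<And>\<eta>. \<eta> \<in> fib S \<sigma> \<Longrightarrow> f \<eta> = g \<eta>) \<Longrightarrow> E S f \<sigma> = E S g \<sigma>"
  unfolding E_def by (simp cong: sum.cong)

lemma E_fib: "\<eta> \<in> fib S \<sigma> \<Longrightarrow> E S f \<eta> = E S f \<sigma>"
  unfolding E_def mass_def by (simp add: fib_eq)

lemma E_ignores: "ignores S (E S f)"
  by (auto simp: ignores_def E_fib)

lemma E_add: "E S (\<lambda>\<sigma>. f \<sigma> + g \<sigma>) \<sigma> = E S f \<sigma> + E S g \<sigma>"
  unfolding E_def by (simp add: algebra_simps sum.distrib add_divide_distrib)

lemma E_diff: "E S (\<lambda>\<sigma>. f \<sigma> - g \<sigma>) \<sigma> = E S f \<sigma> - E S g \<sigma>"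
  unfolding E_def by (simp add: algebra_simps sum_subtractf diff_divide_distrib)

lemma E_sum: "E S (\<lambda>\<sigma>. \<Sum>i\<in>I. c i * f i \<sigma>) \<sigma> = (\<Sum>i\<in>I. c i * E S (f i) \<sigma>)"
proof -
  have "(\<Sum>\<eta>\<in>fib S \<sigma>. W \<eta> * (\<Sum>i\<in>I. c i * f i \<eta>)) = (\<Sum>i\<in>I. c i * (\<Sum>\<eta>\<in>fib S \<sigma>. W \<eta> * f i \<eta>))"
    unfolding sum_distrib_left by (subst sum.swap) (simp add: algebra_simps)
  then show ?thesis
    unfolding E_def by (simp add: sum_divide_distrib[of _ I])
qed

lemma E_nonneg: "(\<And>\<eta>. \<eta> \<in> fib S \<sigma> \<Longrightarrow> 0 \<le> f \<eta>) \<Longrightarrow> 0 \<le> E S f \<sigma>"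
  unfolding E_def mass_def using W_pos fib_in
  by (intro divide_nonneg_nonneg sum_nonneg mult_nonneg_nonneg) (auto intro: less_imp_le)

lemma E_mono: "(\<And>\<eta>. \<eta> \<in> fib S \<sigma> \<Longrightarrow> f \<eta> \<le> g \<eta>) \<Longrightarrow> E S f \<sigma> \<le> E S g \<sigma>"
  using E_nonneg[of S \<sigma> "\<lambda>\<eta>. g \<eta> - f \<eta>"] by (simp add: E_diff)

lemma E_ignored_mult:
  assumes "ignores S h" "\<sigma> \<in> \<Omega>"
  shows "E S (\<lambda>\<eta>. h \<eta> * f \<eta>) \<sigma> = h \<sigma> * E S f \<sigma>"
proof -
  have "E S (\<lambda>\<eta>. h \<eta> * f \<eta>) \<sigma> = E S (\<lambda>\<eta>. h \<sigma> * f \<eta>) \<sigma>"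
    using assms by (intro E_cong) (simp add: ignoresD)
  then show ?thesis
    unfolding E_def by (simp add: sum_distrib_left algebra_simps)
qed

lemma E_one: "\<sigma> \<in> \<Omega> \<Longrightarrow> E S (\<lambda>_. 1) \<sigma> = 1"
  using mass_pos[of \<sigma> S] unfolding E_def by (simp add: mass_def)

lemma E_ignored: "ignores S h \<Longrightarrow> \<sigma> \<in> \<Omega> \<Longrightarrow> E S h \<sigma> = h \<sigma>"
  using E_ignored_mult[of S h \<sigma> "\<lambda>_. 1"] by (simp add: E_one)

lemma ip_cong: "(\<And>\<sigma>. \<sigma> \<in> \<Omega> \<Longrightarrow> f \<sigma> = f' \<sigma>) \<Longrightarrow> (\<And>\<sigma>. \<sigma> \<in> \<Omega> \<Longrightarrow> g \<sigma> = g' \<sigma>) \<Longrightarrow> ip f g = ip f' g'"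
  unfolding ip_def by (simp cong: sum.cong)

lemma ip_commute: "ip f g = ip g f"
  unfolding ip_def by (simp add: algebra_simps)

lemma nrm2_nonneg: "0 \<le> nrm2 f"
  unfolding ip_def using W_pos by (intro sum_nonneg) (simp add: mult.assoc less_imp_le)

lemma nrm2_pos: "\<sigma> \<in> \<Omega> \<Longrightarrow> f \<sigma> \<noteq> 0 \<Longrightarrow> 0 < nrm2 f"
  unfolding ip_def mult.assoc using W_pos
  by (intro sum_pos2[of _ \<sigma>] finite_\<Omega>) (auto simp: less_imp_le zero_less_mult_iff linorder_neq_iff)

lemma ip_diff_left: "ip (\<lambda>\<sigma>. f \<sigma> - g \<sigma>) k = ip f k - ip g k"
  unfolding ip_def by (simp add: algebra_simps sum_subtractf)

lemma ip_diff_right: "ip k (\<lambda>\<sigma>. f \<sigma> - g \<sigma>) = ip k f - ip k g"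
  unfolding ip_def by (simp add: algebra_simps sum_subtractf)

lemma sum_fib_eq_if: "(\<Sum>\<eta>\<in>fib S \<sigma>. k \<eta>) = (\<Sum>\<eta>\<in>\<Omega>. if \<eta> \<in> fib S \<sigma> then k \<eta> else (0::real))"
  using sum.inter_restrict[OF finite_\<Omega>, of k "fib S \<sigma>"]
  by (simp add: Int_absorb1[OF fib_subset])

text \<open>Detailed balance: within a fibre the kernel times \<open>W \<sigma>\<close> is
  \<open>W \<sigma> * W \<eta> / mass S \<sigma>\<close>, which is symmetric because
  \<open>mass S\<close> is constant on the fibre.\<close>

lemma ip_E: "ip (E S f) g = ip f (E S g)"
proof -
  have "ip (E S f) g = (\<Sum>\<sigma>\<in>\<Omega>. \<Sum>\<eta>\<in>fib S \<sigma>. W \<sigma> * W \<eta> * f \<eta> * g \<sigma> / mass S \<sigma>)"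
    unfolding ip_def E_def
    by (simp add: sum_distrib_left sum_distrib_right sum_divide_distrib mult_ac)
  also have "\<dots> = (\<Sum>\<sigma>\<in>\<Omega>. \<Sum>\<eta>\<in>\<Omega>. if \<eta> \<in> fib S \<sigma> then W \<sigma> * W \<eta> * f \<eta> * g \<sigma> / mass S \<sigma> else 0)"
    by (simp only: sum_fib_eq_if)
  also have "\<dots> = (\<Sum>\<eta>\<in>\<Omega>. \<Sum>\<sigma>\<in>\<Omega>. if \<eta> \<in> fib S \<sigma> then W \<sigma> * W \<eta> * f \<eta> * g \<sigma> / mass S \<sigma> else 0)"
    by (rule sum.swap)
  also have "\<dots> = (\<Sum>\<eta>\<in>\<Omega>. \<Sum>\<sigma>\<in>\<Omega>. if \<sigma> \<in> fib S \<eta> then W \<sigma> * W \<eta> * f \<eta> * g \<sigma> / mass S \<eta> else 0)"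
  proof (intro sum.cong refl)
    fix \<eta> \<sigma> assume "\<eta> \<in> \<Omega>" "\<sigma> \<in> \<Omega>"
    then have "\<eta> \<in> fib S \<sigma> \<longleftrightarrow> \<sigma> \<in> fib S \<eta>" using fib_sym by blast
    moreover have "\<eta> \<in> fib S \<sigma> \<Longrightarrow> mass S \<eta> = mass S \<sigma>" by (simp add: mass_def fib_eq)
    ultimately show "(if \<eta> \<in> fib S \<sigma> then W \<sigma> * W \<eta> * f \<eta> * g \<sigma> / mass S \<sigma> else 0) =
      (if \<sigma> \<in> fib S \<eta> then W \<sigma> * W \<eta> * f \<eta> * g \<sigma> / mass S \<eta> else 0)" by simp
  qed
  also have "\<dots> = (\<Sum>\<eta>\<in>\<Omega>. \<Sum>\<sigma>\<in>fib S \<eta>. W \<sigma> * W \<eta> * f \<eta> * g \<sigma> / mass S \<eta>)"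
    by (simp only: sum_fib_eq_if)
  also have "\<dots> = ip f (E S g)"
    unfolding ip_def E_def
    by (simp add: sum_distrib_left sum_distrib_right sum_divide_distrib mult_ac)
  finally show ?thesis .
qed

lemma E_tower:
  assumes "S \<subseteq> T" "\<sigma> \<in> \<Omega>"
  shows "E T (E S f) \<sigma> = E T f \<sigma>"
proof -
  \<comment> \<open>Pairing with the indicator of the larger fibre: it ignores \<open>S\<close>
    because \<open>S \<subseteq> T\<close>, so self-adjointness moves \<open>E S\<close> onto it,
    where it acts as the identity.\<close>
  let ?I = "\<lambda>\<eta>. if \<eta> \<in> fib T \<sigma> then 1 else (0::real)"
  have int: "ip k ?I = (\<Sum>\<eta>\<in>fib T \<sigma>. W \<eta> * k \<eta>)" for k
    unfolding ip_def sum_fib_eq_if by (intro sum.cong) auto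
  have "ignores S ?I"
    unfolding ignores_def
  proof (intro ballI)
    fix \<zeta> \<eta> assume "\<zeta> \<in> \<Omega>" "\<eta> \<in> fib S \<zeta>"
    then have "\<eta> \<in> \<Omega>" and agree: "\<And>u. u \<notin> T \<Longrightarrow> \<eta> u = \<zeta> u"
      using assms(1) by (auto simp: fib_def)
    then show "?I \<eta> = ?I \<zeta>" using \<open>\<zeta> \<in> \<Omega>\<close> by (auto simp: fib_def)
  qed
  then have "ip (E S f) ?I = ip f ?I"
    unfolding ip_E by (intro ip_cong refl) (rule E_ignored)
  then show ?thesis unfolding int E_def[of T] by simp
qed

lemma E_tower': "S \<subseteq> T \<Longrightarrow> \<sigma> \<in> \<Omega> \<Longrightarrow> E S (E T f) \<sigma> = E T f \<sigma>"
  by (rule E_ignored[OF ignores_mono[OF E_ignores]])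

lemma nrm2_E: "nrm2 (E S f) = ip f (E S f)"
  unfolding ip_E by (intro ip_cong refl E_tower') auto

text \<open>Pythagoras for the projection \<open>E S\<close>. Up to normalisation this is the mean
  conditional variance of \<open>f\<close> given the spins outside \<open>S\<close>; variances
  appear below in the form of the right-hand side.\<close>

lemma nrm2_diff_E: "nrm2 (\<lambda>\<sigma>. f \<sigma> - E S f \<sigma>) = nrm2 f - nrm2 (E S f)"
  unfolding ip_diff_left ip_diff_right nrm2_E by (simp add: ip_commute)

lemma nrm2_E_le: "nrm2 (E S f) \<le> nrm2 f"
  using nrm2_nonneg[of "\<lambda>\<sigma>. f \<sigma> - E S f \<sigma>"] by (simp add: nrm2_diff_E)

lemma nrm2_diff_le: "nrm2 (\<lambda>\<sigma>. f \<sigma> - g \<sigma>) \<le> 2 * nrm2 f + 2 * nrm2 g"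
proof -
  have "0 \<le> nrm2 (\<lambda>\<sigma>. f \<sigma> + g \<sigma>)" by (rule nrm2_nonneg)
  also have "\<dots> = 2 * nrm2 f + 2 * nrm2 g - nrm2 (\<lambda>\<sigma>. f \<sigma> - g \<sigma>)"
    unfolding ip_def sum_distrib_left sum.distrib[symmetric] sum_subtractf[symmetric]
    by (intro sum.cong refl) (simp add: algebra_simps)
  finally show ?thesis by simp
qed

lemma sum_W_E: "(\<Sum>\<sigma>\<in>\<Omega>. W \<sigma> * E S f \<sigma>) = (\<Sum>\<sigma>\<in>\<Omega>. W \<sigma> * f \<sigma>)"
proof -
  have "ip (E S f) (\<lambda>_. 1) = ip f (\<lambda>_. 1)"
    unfolding ip_E by (intro ip_cong refl) (simp add: E_one)
  then show ?thesis by (simp add: ip_def)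
qed

section \<open>Functions and sums on fibres of several regions\<close>

lemma ignores_Un:
  assumes "ignores S f" "ignores T f"
  shows "ignores (S \<union> T) f"
  unfolding ignores_def
proof (intro ballI)
  fix \<sigma> \<eta> assume \<sigma>: "\<sigma> \<in> \<Omega>" and \<eta>: "\<eta> \<in> fib (S \<union> T) \<sigma>"
  \<comment> \<open>With this hybrid the change from \<open>\<sigma>\<close> to
    \<open>\<eta>\<close> is made first on \<open>S\<close> and then within
    \<open>T\<close>.\<close>
  let ?\<zeta> = "\<lambda>u. if u \<in> S then \<eta> u else \<sigma> u"
  have \<zeta>: "?\<zeta> \<in> \<Omega>" using mix_closed[OF \<sigma> fib_in[OF \<eta>]] .
  then have "?\<zeta> \<in> fib S \<sigma>" by (simp add: fib_def)
  moreover have "\<eta> \<in> fib T ?\<zeta>" using \<eta> by (auto simp: fib_def)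
  ultimately show "f \<eta> = f \<sigma>"
    using ignoresD[OF assms(1) \<sigma>] ignoresD[OF assms(2) \<zeta>] by simp
qed

lemma ignores_UN:
  assumes "finite J" "\<And>j. j \<in> J \<Longrightarrow> ignores (S j) f"
  shows "ignores (\<Union>j\<in>J. S j) f"
  using assms
proof (induction J rule: finite_induct)
  case empty
  show ?case by (auto simp: ignores_def fib_def simp flip: fun_eq_iff)
next
  case (insert j J)
  then show ?case by (auto intro!: ignores_Un)
qed

lemma ignores_prod:
  fixes F :: "'i \<Rightarrow> ('v \<Rightarrow> 's) \<Rightarrow> 'c::comm_monoid_mult"
  assumes "\<And>i. i \<in> I \<Longrightarrow> ignores S (F i)"
  shows "ignores S (\<lambda>\<eta>. \<Prod>i\<in>I. F i \<eta>)"
  using assms by (auto simp: ignores_def intro!: prod.cong)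

lemma nrm2_cong: "(\<And>\<sigma>. \<sigma> \<in> \<Omega> \<Longrightarrow> f \<sigma> = g \<sigma>) \<Longrightarrow> nrm2 f = nrm2 g"
  by (rule ip_cong)

text \<open>Replacing the spins outside \<open>S\<close> by those of the other base point is a
  bijection of the fibres. It changes a configuration only inside \<open>X\<close>, where
  \<open>k\<close> is blind.\<close>

lemma sum_fib_transport:
  fixes k :: "_ \<Rightarrow> real"
  assumes disj: "S \<inter> X = {}" and k: "ignores X k" and \<sigma>: "\<sigma> \<in> \<Omega>" and \<sigma>': "\<sigma>' \<in> fib X \<sigma>"
  shows "(\<Sum>\<eta>\<in>fib S \<sigma>'. k \<eta>) = (\<Sum>\<eta>\<in>fib S \<sigma>. k \<eta>)"
proof (rule sum.reindex_bij_witness[where i = "\<lambda>\<eta> u. if u \<in> S then \<eta> u else \<sigma>' u"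
      and j = "\<lambda>\<eta> u. if u \<in> S then \<eta> u else \<sigma> u"])
  fix \<eta> assume \<eta>: "\<eta> \<in> fib S \<sigma>'"
  show "(\<lambda>u. if u \<in> S then (if u \<in> S then \<eta> u else \<sigma> u) else \<sigma>' u) = \<eta>"
    using \<eta> by (auto simp: fib_def)
  show in': "(\<lambda>u. if u \<in> S then \<eta> u else \<sigma> u) \<in> fib S \<sigma>"
    using mix_closed[OF \<sigma> fib_in[OF \<eta>]] by (simp add: fib_def)
  show "k (\<lambda>u. if u \<in> S then \<eta> u else \<sigma> u) = k \<eta>"
    using \<eta> \<sigma>' in' by (intro ignoresD[OF k fib_in[OF \<eta>]]) (auto simp: fib_def)
next
  fix \<eta> assume \<eta>: "\<eta> \<in> fib S \<sigma>"
  show "(\<lambda>u. if u \<in> S then (if u \<in> S then \<eta> u else \<sigma>' u) else \<sigma> u) = \<eta>"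
    using \<eta> by (auto simp: fib_def)
  show "(\<lambda>u. if u \<in> S then \<eta> u else \<sigma>' u) \<in> fib S \<sigma>'"
    using mix_closed[OF fib_in[OF \<sigma>'] fib_in[OF \<eta>]] by (simp add: fib_def)
qed

text \<open>The factor \<open>W1\<close> is constant on each fibre of \<open>S\<close> and cancels
  from the quotient; the remaining sums involve only functions that ignore \<open>X\<close>, so
  \<open>sum_fib_transport\<close> applies.\<close>

lemma E_preserves_ignores:
  assumes disj: "S \<inter> X = {}"
    and W: "\<And>\<sigma>. \<sigma> \<in> \<Omega> \<Longrightarrow> W \<sigma> = W1 \<sigma> * W2 \<sigma>"
    and W1: "ignores S W1" and W2: "ignores X W2"
    and f: "ignores X f"
  shows "ignores X (E S f)"
  unfolding ignores_def
proof (intro ballI)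
  fix \<sigma> \<sigma>' assume \<sigma>: "\<sigma> \<in> \<Omega>" and \<sigma>': "\<sigma>' \<in> fib X \<sigma>"
  have reduce: "E S f \<zeta> = (\<Sum>\<eta>\<in>fib S \<zeta>. W2 \<eta> * f \<eta>) / (\<Sum>\<eta>\<in>fib S \<zeta>. W2 \<eta>)" if "\<zeta> \<in> \<Omega>" for \<zeta>
  proof -
    have *: "W \<eta> = W1 \<zeta> * W2 \<eta>" if "\<eta> \<in> fib S \<zeta>" for \<eta>
      using W[of \<eta>] ignoresD[OF W1 \<open>\<zeta> \<in> \<Omega>\<close> that] fib_in[OF that] by simp
    have "W1 \<zeta> \<noteq> 0" using W[OF that] W_pos[OF that] by auto
    moreover have "(\<Sum>\<eta>\<in>fib S \<zeta>. W \<eta> * f \<eta>) = W1 \<zeta> * (\<Sum>\<eta>\<in>fib S \<zeta>. W2 \<eta> * f \<eta>)"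
      by (simp add: * sum_distrib_left mult.assoc cong: sum.cong)
    moreover have "mass S \<zeta> = W1 \<zeta> * (\<Sum>\<eta>\<in>fib S \<zeta>. W2 \<eta>)"
      unfolding mass_def by (simp add: * sum_distrib_left cong: sum.cong)
    ultimately show ?thesis by (simp add: E_def)
  qed
  have "ignores X (\<lambda>\<eta>. W2 \<eta> * f \<eta>)" using W2 f by (auto simp: ignores_def)
  then show "E S f \<sigma>' = E S f \<sigma>"
    using \<sigma> fib_in[OF \<sigma>'] by (simp add: reduce sum_fib_transport[OF disj W2 \<sigma> \<sigma>'] sum_fib_transport[OF disj _ \<sigma> \<sigma>'])
qed

text \<open>Fubini: by splicing, the fibre over a disjoint union is the product of the two
  fibres.\<close>

lemma sum_fib_Un:
  fixes F G :: "_ \<Rightarrow> real"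
  assumes disj: "S \<inter> T = {}" and F: "ignores T F" and G: "ignores S G" and \<sigma>: "\<sigma> \<in> \<Omega>"
  shows "(\<Sum>\<eta>\<in>fib (S \<union> T) \<sigma>. F \<eta> * G \<eta>) = (\<Sum>\<eta>\<in>fib S \<sigma>. F \<eta>) * (\<Sum>\<eta>\<in>fib T \<sigma>. G \<eta>)"
proof -
  have "(\<Sum>\<eta>\<in>fib S \<sigma>. F \<eta>) * (\<Sum>\<eta>\<in>fib T \<sigma>. G \<eta>) = (\<Sum>(\<eta>,\<zeta>)\<in>fib S \<sigma> \<times> fib T \<sigma>. F \<eta> * G \<zeta>)"
    by (simp add: sum_product sum.cartesian_product)
  also have "\<dots> = (\<Sum>\<eta>\<in>fib (S \<union> T) \<sigma>. F \<eta> * G \<eta>)"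
  proof (rule sum.reindex_bij_witness[where
        i = "\<lambda>\<xi>. (\<lambda>u. if u \<in> S then \<xi> u else \<sigma> u, \<lambda>u. if u \<in> T then \<xi> u else \<sigma> u)"
        and j = "\<lambda>(\<eta>,\<zeta>) u. if u \<in> S then \<eta> u else \<zeta> u"])
    fix a assume "a \<in> fib S \<sigma> \<times> fib T \<sigma>"
    then obtain \<eta> \<zeta> where a: "a = (\<eta>, \<zeta>)" and \<eta>: "\<eta> \<in> fib S \<sigma>" and \<zeta>: "\<zeta> \<in> fib T \<sigma>" by auto
    let ?\<xi> = "\<lambda>u. if u \<in> S then \<eta> u else \<zeta> u"
    have \<xi>: "?\<xi> \<in> \<Omega>" using mix_closed[OF fib_in[OF \<zeta>] fib_in[OF \<eta>]] .
    show "(\<lambda>u. if u \<in> S then (case a of (\<eta>,\<zeta>) \<Rightarrow> \<lambda>u. if u \<in> S then \<eta> u else \<zeta> u) u else \<sigma> u,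
        \<lambda>u. if u \<in> T then (case a of (\<eta>,\<zeta>) \<Rightarrow> \<lambda>u. if u \<in> S then \<eta> u else \<zeta> u) u else \<sigma> u) = a"
      using \<eta> \<zeta> disj unfolding a by (auto simp: fib_def fun_eq_iff)
    show "(case a of (\<eta>,\<zeta>) \<Rightarrow> \<lambda>u. if u \<in> S then \<eta> u else \<zeta> u) \<in> fib (S \<union> T) \<sigma>"
      using \<xi> \<eta> \<zeta> unfolding a by (auto simp: fib_def)
    have "F ?\<xi> = F \<eta>"
      using \<xi> \<eta> \<zeta> by (intro ignoresD[OF F fib_in[OF \<eta>]]) (auto simp: fib_def)
    moreover have "G ?\<xi> = G \<zeta>"
      using \<xi> \<eta> \<zeta> by (intro ignoresD[OF G fib_in[OF \<zeta>]]) (auto simp: fib_def)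
    ultimately show "F (case a of (\<eta>,\<zeta>) \<Rightarrow> \<lambda>u. if u \<in> S then \<eta> u else \<zeta> u) *
        G (case a of (\<eta>,\<zeta>) \<Rightarrow> \<lambda>u. if u \<in> S then \<eta> u else \<zeta> u) = (case a of (\<eta>,\<zeta>) \<Rightarrow> F \<eta> * G \<zeta>)"
      unfolding a by simp
  next
    fix \<xi> assume \<xi>: "\<xi> \<in> fib (S \<union> T) \<sigma>"
    show "(case (\<lambda>u. if u \<in> S then \<xi> u else \<sigma> u, \<lambda>u. if u \<in> T then \<xi> u else \<sigma> u) of
        (\<eta>,\<zeta>) \<Rightarrow> \<lambda>u. if u \<in> S then \<eta> u else \<zeta> u) = \<xi>"
      using \<xi> by (auto simp: fib_def fun_eq_iff)
    show "(\<lambda>u. if u \<in> S then \<xi> u else \<sigma> u, \<lambda>u. if u \<in> T then \<xi> u else \<sigma> u) \<in> fib S \<sigma> \<times> fib T \<sigma>"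
      using mix_closed[OF \<sigma> fib_in[OF \<xi>]] by (auto simp: fib_def)
  qed
  finally show ?thesis ..
qed

lemma sum_fib_UN:
  fixes F :: "'i \<Rightarrow> ('v \<Rightarrow> 's) \<Rightarrow> real"
  assumes "finite I" and "\<sigma> \<in> \<Omega>"
    and "\<And>i j. i \<in> I \<Longrightarrow> j \<in> I \<Longrightarrow> i \<noteq> j \<Longrightarrow> S i \<inter> S j = {} \<and> ignores (S j) (F i)"
  shows "(\<Sum>\<eta>\<in>fib (\<Union>i\<in>I. S i) \<sigma>. \<Prod>i\<in>I. F i \<eta>) = (\<Prod>i\<in>I. \<Sum>\<eta>\<in>fib (S i) \<sigma>. F i \<eta>)"
  using assms
proof (induction I rule: finite_induct)
  case empty
  have "fib {} \<sigma> = {\<sigma>}" using empty(1) by (auto simp: fib_def)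
  then show ?case by simp
next
  case (insert i I)
  have F: "ignores (\<Union>j\<in>I. S j) (F i)"
    using insert.hyps insert.prems(2)[of i] by (intro ignores_UN) auto
  have G: "ignores (S i) (\<lambda>\<eta>. \<Prod>j\<in>I. F j \<eta>)"
    using insert.hyps insert.prems(2)[of _ i] by (intro ignores_prod) auto
  have disj: "S i \<inter> (\<Union>j\<in>I. S j) = {}"
    using insert.prems(2)[of i] insert.hyps by auto
  have IH: "(\<Sum>\<eta>\<in>fib (\<Union>j\<in>I. S j) \<sigma>. \<Prod>j\<in>I. F j \<eta>) = (\<Prod>j\<in>I. \<Sum>\<eta>\<in>fib (S j) \<sigma>. F j \<eta>)"
    using insert.prems by (intro insert.IH) auto
  show ?case
    using insert.hyps sum_fib_Un[OF disj F G insert.prems(1)] by (simp add: IH)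
qed

end

section \<open>Markov fields and separated regions\<close>

text \<open>The spatial Markov property, put as a factorisation of the weight in which no factor
  sees both \<open>S\<close> and \<open>X\<close>.\<close>

locale markov_field = spin_system \<Omega> W
  for \<Omega> :: "('v \<Rightarrow> 's) set" and W +
  fixes adj :: "'v \<Rightarrow> 'v \<Rightarrow> bool"
  assumes factor: "S \<inter> X = {} \<Longrightarrow> \<forall>u\<in>S. \<forall>x\<in>X. \<not> adj u x \<and> \<not> adj x u \<Longrightarrow>
    \<exists>W1 W2. (\<forall>\<sigma>\<in>\<Omega>. W \<sigma> = W1 \<sigma> * W2 \<sigma>) \<and> ignores S W1 \<and> ignores X W2"
begin

text \<open>\<open>adj\<close> may be oriented, as the child-parent relation of the tree is, so both
  directions are excluded.\<close>

definition sep :: "'v set \<Rightarrow> 'v set \<Rightarrow> bool" where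
  "sep S X \<longleftrightarrow> S \<inter> X = {} \<and> (\<forall>u\<in>S. \<forall>x\<in>X. \<not> adj u x \<and> \<not> adj x u)"

lemma sep_sym: "sep S X \<Longrightarrow> sep X S"
  by (auto simp: sep_def)

lemma sep_mono: "sep S X \<Longrightarrow> S' \<subseteq> S \<Longrightarrow> X' \<subseteq> X \<Longrightarrow> sep S' X'"
  unfolding sep_def by blast

lemma sep_UN: "(\<And>j. j \<in> J \<Longrightarrow> sep S (X j)) \<Longrightarrow> sep S (\<Union>j\<in>J. X j)"
  unfolding sep_def by blast

lemma ignores_E:
  assumes "sep S X" "ignores X f"
  shows "ignores X (E S f)"
proof -
  have "S \<inter> X = {}" and "\<forall>u\<in>S. \<forall>x\<in>X. \<not> adj u x \<and> \<not> adj x u"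
    using assms(1) by (auto simp: sep_def)
  from factor[OF this] obtain W1 W2
    where "\<forall>\<sigma>\<in>\<Omega>. W \<sigma> = W1 \<sigma> * W2 \<sigma>" "ignores S W1" "ignores X W2" by auto
  with \<open>S \<inter> X = {}\<close> assms(2) show ?thesis by (intro E_preserves_ignores[of S X W1 W2]) auto
qed

text \<open>By the Markov property the left side ignores \<open>T\<close> as well as
  \<open>S\<close>, so it is fixed by \<open>E (S \<union> T)\<close>, which absorbs both inner
  expectations. In particular \<open>E S\<close> and \<open>E T\<close> commute.\<close>

lemma E_E_sep:
  assumes "sep S T" "\<sigma> \<in> \<Omega>"
  shows "E S (E T f) \<sigma> = E (S \<union> T) f \<sigma>"
proof -
  have "ignores (S \<union> T) (E S (E T f))"
    using assms by (intro ignores_Un E_ignores ignores_E)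
  then have "E S (E T f) \<sigma> = E (S \<union> T) (E S (E T f)) \<sigma>"
    using assms by (simp add: E_ignored)
  also have "\<dots> = E (S \<union> T) f \<sigma>"
    using assms by (simp add: E_tower)
  finally show ?thesis .
qed

lemma E_E_sep': "sep S T \<Longrightarrow> \<sigma> \<in> \<Omega> \<Longrightarrow> E T (E S f) \<sigma> = E (S \<union> T) f \<sigma>"
  using E_E_sep[of T S \<sigma> f] by (simp add: sep_sym Un_commute)

lemma E_Un_mult:
  assumes "sep S T" "ignores T f" "ignores S g" "\<sigma> \<in> \<Omega>"
  shows "E (S \<union> T) (\<lambda>\<eta>. f \<eta> * g \<eta>) \<sigma> = E S f \<sigma> * E T g \<sigma>"
proof -
  have "E (S \<union> T) (\<lambda>\<eta>. f \<eta> * g \<eta>) \<sigma> = E S (E T (\<lambda>\<eta>. f \<eta> * g \<eta>)) \<sigma>"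
    using assms by (simp add: E_E_sep)
  also have "\<dots> = E S (\<lambda>\<eta>. E T g \<eta> * f \<eta>) \<sigma>"
    using assms by (intro E_cong) (simp add: E_ignored_mult fib_in mult.commute)
  also have "\<dots> = E T g \<sigma> * E S f \<sigma>"
    using assms by (intro E_ignored_mult ignores_E) (simp_all add: sep_sym)
  finally show ?thesis by (simp add: mult.commute)
qed

lemma E_UN_prod:
  assumes "finite I" "\<sigma> \<in> \<Omega>"
    and "\<And>i j. i \<in> I \<Longrightarrow> j \<in> I \<Longrightarrow> i \<noteq> j \<Longrightarrow> sep (S i) (S j) \<and> ignores (S j) (F i)"
  shows "E (\<Union>i\<in>I. S i) (\<lambda>\<eta>. \<Prod>i\<in>I. F i \<eta>) \<sigma> = (\<Prod>i\<in>I. E (S i) (F i) \<sigma>)"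
  using assms
proof (induction I rule: finite_induct)
  case empty
  then show ?case by (simp add: E_one)
next
  case (insert i I)
  have "ignores (\<Union>j\<in>I. S j) (F i)"
    using insert.hyps insert.prems(2)[of i] by (intro ignores_UN) auto
  moreover have "ignores (S i) (\<lambda>\<eta>. \<Prod>j\<in>I. F j \<eta>)"
    using insert.hyps insert.prems(2)[of _ i] by (intro ignores_prod) auto
  moreover have "sep (S i) (\<Union>j\<in>I. S j)"
    using insert.hyps insert.prems(2)[of i] by (intro sep_UN) auto
  ultimately show ?case
    using insert E_Un_mult by simp
qed

text \<open>The contraction \<open>E S\<close> is applied to \<open>f - E T f\<close>. Equivalently,
  the variance over \<open>S \<union> T\<close> is at most the sum of those over \<open>S\<close>
  and over \<open>T\<close>.\<close>

lemma nrm2_E_sep: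
  assumes "sep S T"
  shows "nrm2 (E S f) + nrm2 (E T f) \<le> nrm2 f + nrm2 (E (S \<union> T) f)"
proof -
  have "nrm2 (E S f) - nrm2 (E (S \<union> T) f) = nrm2 (E S f) - nrm2 (E T (E S f))"
    using nrm2_cong[OF E_E_sep'[OF assms]] by simp
  also have "\<dots> = nrm2 (\<lambda>\<sigma>. E S f \<sigma> - E T (E S f) \<sigma>)" by (simp add: nrm2_diff_E)
  also have "\<dots> = nrm2 (E S (\<lambda>\<sigma>. f \<sigma> - E T f \<sigma>))"
    by (intro nrm2_cong) (simp add: E_diff E_E_sep[OF assms] E_E_sep'[OF assms])
  also have "\<dots> \<le> nrm2 (\<lambda>\<sigma>. f \<sigma> - E T f \<sigma>)" by (rule nrm2_E_le)
  also have "\<dots> = nrm2 f - nrm2 (E T f)" by (rule nrm2_diff_E)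
  finally show ?thesis by simp
qed

lemma efron_stein:
  assumes "finite I" "\<And>i j. i \<in> I \<Longrightarrow> j \<in> I \<Longrightarrow> i \<noteq> j \<Longrightarrow> sep (S i) (S j)"
  shows "nrm2 f - nrm2 (E (\<Union>i\<in>I. S i) f) \<le> (\<Sum>i\<in>I. nrm2 f - nrm2 (E (S i) f))"
  using assms
proof (induction I rule: finite_induct)
  case empty
  have "nrm2 (E {} f) = nrm2 f"
    by (intro nrm2_cong E_ignored) (auto simp: ignores_def fib_def simp flip: fun_eq_iff)
  then show ?case by simp
next
  case (insert i I)
  have "sep (S i) (\<Union>j\<in>I. S j)"
    using insert.hyps insert.prems[of i] by (intro sep_UN) auto
  from nrm2_E_sep[OF this, of f] show ?case
    using insert.IH insert.prems insert.hyps by simp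
qed

text \<open>Squared maximal correlation does not grow when independent pairs are combined.
  \<open>X i\<close> is the unobserved part of the region \<open>S i\<close>, and \<open>R i\<close>
  is what is still averaged after the rest of \<open>S i\<close> has been revealed. Averaging over
  the other regions keeps a function blind to \<open>X i\<close>, so the hypothesis for
  \<open>i\<close> remains applicable.\<close>

lemma tensorize:
  assumes "finite I" and "\<And>i j. i \<in> I \<Longrightarrow> j \<in> I \<Longrightarrow> i \<noteq> j \<Longrightarrow> sep (S i) (S j)"
    and "\<And>i. i \<in> I \<Longrightarrow> R i \<subseteq> S i" and "\<And>i. i \<in> I \<Longrightarrow> X i \<subseteq> S i"
    and c: "0 \<le> c" "c \<le> 1"
    and "\<And>i f. i \<in> I \<Longrightarrow> ignores (X i) f \<Longrightarrow> nrm2 (E (R i) f) \<le> c * nrm2 f + (1 - c) * nrm2 (E (S i) f)"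
    and "\<And>i. i \<in> I \<Longrightarrow> ignores (X i) g"
  shows "nrm2 (E (\<Union>i\<in>I. R i) g) \<le> c * nrm2 g + (1 - c) * nrm2 (E (\<Union>i\<in>I. S i) g)"
  using assms(1-4,7-8)
proof (induction I arbitrary: g rule: finite_induct)
  case empty
  have "nrm2 (E {} g) = nrm2 g"
    by (intro nrm2_cong E_ignored) (auto simp: ignores_def fib_def simp flip: fun_eq_iff)
  then show ?case by (simp add: algebra_simps)
next
  case (insert i I)
  let ?R = "\<Union>j\<in>I. R j" and ?S = "\<Union>j\<in>I. S j"
  have sep: "sep (S i) (S j)" if "j \<in> I" for j
    using that insert.hyps insert.prems(1)[of i j] by auto
  have RS: "R i \<subseteq> S i" "X i \<subseteq> S i" "?R \<subseteq> ?S"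
    using insert.prems(2,3) by blast+
  have sepS: "sep (S i) ?S" by (intro sep_UN sep)
  have sepSR: "sep (S i) ?R" by (rule sep_mono[OF sepS]) (use RS in auto)
  have sepR: "sep (R i) ?R" by (rule sep_mono[OF sepS]) (use RS in auto)
  have sepX: "sep ?R (X i)" by (rule sep_mono[OF sep_sym[OF sepS]]) (use RS in auto)
  have IH: "nrm2 (E ?R f) \<le> c * nrm2 f + (1 - c) * nrm2 (E ?S f)" if "\<And>j. j \<in> I \<Longrightarrow> ignores (X j) f" for f
    using insert.prems that by (intro insert.IH) auto
  have "nrm2 (E (R i \<union> ?R) g) = nrm2 (E (R i) (E ?R g))"
    by (intro nrm2_cong) (simp add: E_E_sep[OF sepR])
  also have "\<dots> \<le> c * nrm2 (E ?R g) + (1 - c) * nrm2 (E (S i) (E ?R g))"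
    using insert.prems(4,5) by (auto intro: ignores_E[OF sepX])
  also have "nrm2 (E (S i) (E ?R g)) = nrm2 (E ?R (E (S i) g))"
    by (intro nrm2_cong) (simp add: E_E_sep[OF sepSR] E_E_sep'[OF sepSR])
  also have "c * nrm2 (E ?R g) + (1 - c) * nrm2 (E ?R (E (S i) g)) \<le>
      c * (c * nrm2 g + (1 - c) * nrm2 (E ?S g)) +
      (1 - c) * (c * nrm2 (E (S i) g) + (1 - c) * nrm2 (E ?S (E (S i) g)))"
  proof (intro add_mono mult_left_mono IH)
    fix j assume j: "j \<in> I"
    show "ignores (X j) g" using insert.prems(5) j by blast
    show "ignores (X j) (E (S i) g)"
      using j insert.prems by (intro ignores_E[OF sep_mono[OF sep[OF j]]]) auto
  qed (use c in auto)
  also have "nrm2 (E ?S (E (S i) g)) = nrm2 (E (S i \<union> ?S) g)"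
    by (intro nrm2_cong) (simp add: E_E_sep'[OF sepS])
  also have "c * (c * nrm2 g + (1 - c) * nrm2 (E ?S g)) +
      (1 - c) * (c * nrm2 (E (S i) g) + (1 - c) * nrm2 (E (S i \<union> ?S) g)) \<le>
      c * nrm2 g + (1 - c) * nrm2 (E (S i \<union> ?S) g)"
  \<comment> \<open>The right side minus the left is \<open>c * (1 - c)\<close> times the surplus in
    \<open>nrm2_E_sep\<close>.\<close>
  proof -
    have "0 \<le> (c * (1 - c)) * (nrm2 g + nrm2 (E (S i \<union> ?S) g) - nrm2 (E (S i) g) - nrm2 (E ?S g))"
      using nrm2_E_sep[OF sepS, of g] c by (intro mult_nonneg_nonneg) auto
    then show ?thesis by (simp add: algebra_simps)
  qed
  finally show ?case by simp
qed

end

section \<open>The Ising model on a regular tree\<close>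

lemma finite_tree_V: "finite (tree_V b h)"
proof -
  have "tree_V b h = {xs. set xs \<subseteq> {..<b} \<and> length xs \<le> h}"
    by (auto simp: tree_V_def)
  then show ?thesis by (simp add: finite_lists_length_le)
qed

lemma card_level: "k \<le> h \<Longrightarrow> card (level b h k) = b ^ k"
proof -
  assume "k \<le> h"
  then have "level b h k = {xs. set xs \<subseteq> {..<b} \<and> length xs = k}"
    by (auto simp: level_def tree_V_def)
  then show ?thesis by (simp add: card_lists_length_eq)
qed

lemma finite_configs: "finite (configs b h \<tau>)"
proof (rule finite_subset)
  show "configs b h \<tau> \<subseteq> {\<sigma>. \<forall>v. (v \<in> tree_V b h \<longrightarrow> \<sigma> v \<in> {-1, 1}) \<and> (v \<notin> tree_V b h \<longrightarrow> \<sigma> v = 0)}"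
    by (auto simp: configs_def)
  show "finite {\<sigma> :: config. \<forall>v. (v \<in> tree_V b h \<longrightarrow> \<sigma> v \<in> {-1, 1}) \<and> (v \<notin> tree_V b h \<longrightarrow> \<sigma> v = 0)}"
    by (intro finite_set_of_finite_funs finite_tree_V) auto
qed

lemma ising_weight_pos: "0 < ising_weight b h \<beta> \<sigma>"
  by (simp add: ising_weight_def)

lemma configs_mix:
  "\<sigma> \<in> configs b h \<tau> \<Longrightarrow> \<eta> \<in> configs b h \<tau> \<Longrightarrow> (\<lambda>u. if u \<in> S then \<eta> u else \<sigma> u) \<in> configs b h \<tau>"
  by (auto simp: configs_def)

locale ising_tree =
  fixes b h r :: nat and \<beta> :: real and \<tau> :: config
  assumes b: "2 \<le> b" and r: "r \<le> h" and \<beta>: "0 \<le> \<beta>"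

sublocale ising_tree \<subseteq> spin_system "configs b h \<tau>" "ising_weight b h \<beta>"
  by unfold_locales (auto simp: finite_configs ising_weight_pos configs_mix)

sublocale ising_tree \<subseteq> markov_field "configs b h \<tau>" "ising_weight b h \<beta>"
  "\<lambda>u x. u \<in> tree_V b h \<and> u \<noteq> [] \<and> x = butlast u"
proof
  fix S X :: "vertex set"
  assume disj: "S \<inter> X = {}"
    and adj: "\<forall>u\<in>S. \<forall>x\<in>X. \<not> (u \<in> tree_V b h \<and> u \<noteq> [] \<and> x = butlast u) \<and>
      \<not> (x \<in> tree_V b h \<and> x \<noteq> [] \<and> u = butlast x)"
  \<comment> \<open>An edge is named by its child endpoint. \<open>K\<close> collects the edges
    meeting \<open>S\<close>; none of them meets \<open>X\<close>, as \<open>S\<close> and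
    \<open>X\<close> are disjoint and not adjacent.\<close>
  define K where "K = {u \<in> tree_V b h - {[]}. u \<in> S \<or> butlast u \<in> S}"
  define w where "w A \<sigma> = exp (\<beta> * (\<Sum>u\<in>A. real_of_int (\<sigma> u * \<sigma> (butlast u))))" for A and \<sigma> :: config
  have "ising_weight b h \<beta> \<sigma> = w (tree_V b h - {[]} - K) \<sigma> * w K \<sigma>" for \<sigma>
  proof -
    have "K \<subseteq> tree_V b h - {[]}" by (auto simp: K_def)
    then show ?thesis
      unfolding ising_weight_def ising_energy_def w_def exp_add[symmetric] distrib_left[symmetric]
      by (subst sum.subset_diff[of K]) (auto simp: finite_tree_V)
  qed
  moreover have "ignores S (w (tree_V b h - {[]} - K))"
    unfolding ignores_def w_def
  proof (intro ballI arg_cong[where f = exp] arg_cong[where f = "(*) \<beta>"] sum.cong refl)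
    fix \<sigma> \<eta> u assume "\<eta> \<in> fib S \<sigma>" "u \<in> tree_V b h - {[]} - K"
    then have "\<eta> u = \<sigma> u" "\<eta> (butlast u) = \<sigma> (butlast u)" by (auto simp: fib_def K_def)
    then show "real_of_int (\<eta> u * \<eta> (butlast u)) = real_of_int (\<sigma> u * \<sigma> (butlast u))" by simp
  qed
  moreover have "ignores X (w K)"
    unfolding ignores_def w_def
  proof (intro ballI arg_cong[where f = exp] arg_cong[where f = "(*) \<beta>"] sum.cong refl)
    fix \<sigma> \<eta> u assume \<eta>: "\<eta> \<in> fib X \<sigma>" and u: "u \<in> K"
    have "u \<notin> X" "butlast u \<notin> X" using u disj adj by (auto simp: K_def)
    then have "\<eta> u = \<sigma> u" "\<eta> (butlast u) = \<sigma> (butlast u)" using \<eta> by (auto simp: fib_def)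
    then show "real_of_int (\<eta> u * \<eta> (butlast u)) = real_of_int (\<sigma> u * \<sigma> (butlast u))" by simp
  qed
  ultimately show "\<exists>W1 W2. (\<forall>\<sigma>\<in>configs b h \<tau>. ising_weight b h \<beta> \<sigma> = W1 \<sigma> * W2 \<sigma>) \<and> ignores S W1 \<and> ignores X W2"
    by blast
qed

context ising_tree
begin

abbreviation \<Omega> :: "config set" where "\<Omega> \<equiv> configs b h \<tau>"
abbreviation V :: "vertex set" where "V \<equiv> tree_V b h"

section \<open>Subtrees, observations and likelihoods\<close>

definition T :: "vertex \<Rightarrow> vertex set" where
  "T v = {u \<in> V. \<exists>w. u = v @ w}"

text \<open>Lists outside the tree may be included, since every configuration is 0 there.\<close>

definition Obs :: "vertex set" where
  "Obs = {u. r \<le> length u}"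

definition ind :: "vertex \<Rightarrow> config \<Rightarrow> config \<Rightarrow> real" where
  "ind v y \<eta> = of_bool (\<forall>u\<in>Obs \<inter> T v. \<eta> u = y u)"

text \<open>
  \<open>lik v s y\<close> is the probability of observing \<open>y\<close> on \<open>Obs \<inter> T v\<close> when the spin at \<open>v\<close> is \<open>s\<close>;
  by the Markov property it does not depend on \<open>y\<close> outside \<open>Obs \<inter> T v\<close>.
\<close>

definition lik :: "vertex \<Rightarrow> int \<Rightarrow> config \<Rightarrow> real" where
  "lik v s y = E (T v - {v}) (ind v y) (y(v := s))"

text \<open>The Bhattacharyya affinity of the two laws of the observation, so
  \<open>1 - aff v \<sigma>\<close> is the Hellinger defect. Observations are represented by
  configurations that agree with \<open>\<sigma>\<close> off
  \<open>Obs \<inter> T v\<close>.\<close>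

definition aff :: "vertex \<Rightarrow> config \<Rightarrow> real" where
  "aff v \<sigma> = (\<Sum>y\<in>fib (Obs \<inter> T v) \<sigma>. sqrt (lik v 1 y * lik v (-1) y))"

lemma spin_values: "\<sigma> \<in> \<Omega> \<Longrightarrow> v \<in> V \<Longrightarrow> \<sigma> v = 1 \<or> \<sigma> v = -1"
  by (auto simp: configs_def)

lemma upd_in: "\<sigma> \<in> \<Omega> \<Longrightarrow> v \<in> V \<Longrightarrow> length v < h \<Longrightarrow> s = 1 \<or> s = -1 \<Longrightarrow> \<sigma>(v := s) \<in> \<Omega>"
  by (auto simp: configs_def level_def)

lemma T_self: "v \<in> V \<Longrightarrow> v \<in> T v"
  by (auto simp: T_def)

lemma T_children: "length v < h \<Longrightarrow> T v - {v} = (\<Union>i<b. T (v @ [i]))"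
proof (intro equalityI subsetI)
  fix u assume "u \<in> T v - {v}"
  then obtain w where u: "u \<in> V" "u = v @ w" "w \<noteq> []" by (auto simp: T_def)
  then obtain i w' where "w = i # w'" by (cases w) auto
  then show "u \<in> (\<Union>i<b. T (v @ [i]))" using u by (auto simp: T_def tree_V_def)
qed (auto simp: T_def)

lemma child_in: "v \<in> V \<Longrightarrow> length v < h \<Longrightarrow> i < b \<Longrightarrow> v @ [i] \<in> V"
  by (auto simp: tree_V_def)

lemma sep_T:
  assumes "length v = length w" "v \<noteq> w"
  shows "sep (T v) (T w)"
proof -
  have disj: "u \<notin> T w" if "u \<in> T v" "length v = length w" "v \<noteq> w" for u v w
    using that by (auto simp: T_def)
  have edge: "butlast u \<notin> T w" if uT: "u \<in> T v" and vw: "length v = length w" "v \<noteq> w" for u v w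
  proof
    assume "butlast u \<in> T w"
    then obtain y where y: "butlast u = w @ y" by (auto simp: T_def)
    obtain x where x: "u = v @ x" using uT by (auto simp: T_def)
    show False
    proof (cases "x = []")
      case True
      then have "length w + length y = length v - 1" using x y length_butlast[of u] by auto
      then have "length v = 0" using vw(1) by arith
      then show False using vw by simp
    next
      case False
      then show False using x y vw by (simp add: butlast_append)
    qed
  qed
  show ?thesis
    unfolding sep_def using disj[of _ v w] edge[of _ v w] edge[of _ w v] assms by fastforce
qed

text \<open>\<open>w\<close> is the only vertex of its subtree with a neighbour outside, so removing
  it cuts the subtree off.\<close>

lemma sep_T_outside: "sep (T w - {w}) (- T w)"
proof -
  have 1: "butlast u \<in> T w" if u: "u \<in> T w - {w}" for u
  proof -
    obtain x where x: "u = w @ x" "x \<noteq> []" "u \<in> V" using u by (auto simp: T_def)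
    then have "butlast u = w @ butlast x" by (simp add: butlast_append)
    moreover have "butlast u \<in> V" using x(3) by (auto simp: tree_V_def dest: in_set_butlastD)
    ultimately show ?thesis by (auto simp: T_def)
  qed
  have 2: "x \<in> T w" if x: "x \<in> V" "x \<noteq> []" "butlast x \<in> T w" for x
  proof -
    obtain y where "butlast x = w @ y" using x by (auto simp: T_def)
    then have "x = w @ (y @ [last x])" using append_butlast_last_id[OF x(2)] by simp
    then show ?thesis using x(1) unfolding T_def by blast
  qed
  show ?thesis unfolding sep_def using 1 2 by blast
qed

lemma ignores_ind: "X \<inter> Obs \<inter> T v = {} \<Longrightarrow> ignores X (ind v y)"
proof -
  assume X: "X \<inter> Obs \<inter> T v = {}"
  have "ind v y \<eta> = ind v y \<sigma>" if "\<eta> \<in> fib X \<sigma>" for \<eta> \<sigma>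
  proof -
    have "\<eta> u = \<sigma> u" if "u \<in> Obs \<inter> T v" for u
      using \<open>\<eta> \<in> fib X \<sigma>\<close> that X by (auto simp: fib_def)
    then show ?thesis by (simp add: ind_def)
  qed
  then show ?thesis by (auto simp: ignores_def)
qed

text \<open>The expectation ignores \<open>T w - {w}\<close> by averaging and \<open>- T w\<close>
  by the Markov property, hence everything except the spin at \<open>w\<close>.\<close>

lemma E_ind_base:
  assumes "\<zeta> \<in> \<Omega>" "\<zeta>' \<in> \<Omega>" "\<zeta> w = \<zeta>' w"
  shows "E (T w - {w}) (ind w y) \<zeta> = E (T w - {w}) (ind w y) \<zeta>'"
proof -
  have "ignores ((T w - {w}) \<union> (- T w)) (E (T w - {w}) (ind w y))"
    by (intro ignores_Un E_ignores ignores_E sep_T_outside ignores_ind) auto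
  moreover have "\<zeta> \<in> fib ((T w - {w}) \<union> (- T w)) \<zeta>'"
    using assms by (auto simp: fib_def)
  ultimately show ?thesis using assms by (intro ignoresD)
qed

lemma lik_eq:
  assumes "y \<in> \<Omega>" "\<zeta> \<in> \<Omega>" "v \<in> V" "length v < h"
  shows "E (T v - {v}) (ind v y) \<zeta> = lik v (\<zeta> v) y"
  unfolding lik_def using assms spin_values by (intro E_ind_base upd_in) auto

lemma lik_nonneg: "0 \<le> lik v s y"
  unfolding lik_def by (intro E_nonneg) (simp add: ind_def)

text \<open>Total probability over the observation: \<open>g\<close> does not see the unobserved
  part of \<open>T v\<close>, so on the fibre of \<open>\<sigma>\<close> it is the sum of its values
  \<open>g y\<close> times the indicators of the observations \<open>y\<close>.\<close>

lemma E_given_obs: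
  assumes v: "v \<in> V" "length v < r" and g: "ignores (T v - Obs) g"
    and \<sigma>: "\<sigma> \<in> \<Omega>" and \<eta>: "\<eta> \<in> fib (T v) \<sigma>"
  shows "E (T v - {v}) g \<eta> = (\<Sum>y\<in>fib (Obs \<inter> T v) \<sigma>. lik v (\<eta> v) y * g y)"
proof -
  have \<eta>\<Omega>: "\<eta> \<in> \<Omega>" using \<eta> by (rule fib_in)
  have "E (T v - {v}) g \<eta> = E (T v - {v}) (\<lambda>\<zeta>. \<Sum>y\<in>fib (Obs \<inter> T v) \<sigma>. g y * ind v y \<zeta>) \<eta>"
  proof (rule E_cong)
    fix \<zeta> assume \<zeta>: "\<zeta> \<in> fib (T v - {v}) \<eta>"
    \<comment> \<open>The only representative compatible with \<open>\<zeta>\<close>: observed spins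
      from \<open>\<zeta>\<close>, all others from \<open>\<sigma>\<close>.\<close>
    let ?y = "\<lambda>u. if u \<in> Obs \<inter> T v then \<zeta> u else \<sigma> u"
    have y\<Omega>: "?y \<in> \<Omega>" by (rule configs_mix[OF \<sigma> fib_in[OF \<zeta>]])
    then have y: "?y \<in> fib (Obs \<inter> T v) \<sigma>" by (simp add: fib_def)
    have "ind v y' \<zeta> = of_bool (y' = ?y)" if y': "y' \<in> fib (Obs \<inter> T v) \<sigma>" for y'
    proof -
      have "(\<forall>u\<in>Obs \<inter> T v. \<zeta> u = y' u) \<longleftrightarrow> y' = ?y"
        using y' by (auto simp: fib_def fun_eq_iff)
      then show ?thesis by (simp add: ind_def)
    qed
    then have "(\<Sum>y\<in>fib (Obs \<inter> T v) \<sigma>. g y * ind v y \<zeta>) = (\<Sum>y\<in>fib (Obs \<inter> T v) \<sigma>. if y = ?y then g y else 0)"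
      by (intro sum.cong refl) auto
    also have "\<dots> = g ?y" using y by simp
    also have "g ?y = g \<zeta>"
    proof (rule ignoresD[OF g fib_in[OF \<zeta>]])
      show "?y \<in> fib (T v - Obs) \<zeta>"
        using y\<Omega> \<zeta> \<eta> by (auto simp: fib_def)
    qed
    finally show "g \<zeta> = (\<Sum>y\<in>fib (Obs \<inter> T v) \<sigma>. g y * ind v y \<zeta>)" by simp
  qed
  also have "\<dots> = (\<Sum>y\<in>fib (Obs \<inter> T v) \<sigma>. g y * E (T v - {v}) (ind v y) \<eta>)"
    by (rule E_sum)
  also have "\<dots> = (\<Sum>y\<in>fib (Obs \<inter> T v) \<sigma>. lik v (\<eta> v) y * g y)"
    using v r \<eta>\<Omega> by (intro sum.cong refl) (simp add: lik_eq fib_in mult.commute)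
  finally show ?thesis .
qed

lemma sum_lik:
  assumes "v \<in> V" "length v < r" "\<sigma> \<in> \<Omega>" "s = 1 \<or> s = -1"
  shows "(\<Sum>y\<in>fib (Obs \<inter> T v) \<sigma>. lik v s y) = 1"
proof -
  have \<eta>: "\<sigma>(v := s) \<in> \<Omega>" using assms r by (intro upd_in) auto
  then have "\<sigma>(v := s) \<in> fib (T v) \<sigma>" using T_self[OF assms(1)] by (auto simp: fib_def)
  moreover have "ignores (T v - Obs) (\<lambda>_. 1 :: real)" by (auto simp: ignores_def)
  ultimately show ?thesis
    using E_given_obs[OF assms(1,2), of "\<lambda>_. 1" \<sigma> "\<sigma>(v := s)"] assms(3) \<eta> by (simp add: E_one)
qed

text \<open>Averaging over \<open>T w\<close> in two stages, the spin at \<open>w\<close> last;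
  \<open>m\<close> is its probability of being 1 given the spins outside \<open>T w\<close>.\<close>

lemma E_T_split:
  assumes w: "w \<in> V" and \<sigma>: "\<sigma> \<in> \<Omega>"
    and f: "\<And>\<zeta>. \<zeta> \<in> fib (T w) \<sigma> \<Longrightarrow> E (T w - {w}) f \<zeta> = \<Phi> (\<zeta> w)"
  defines "m \<equiv> E (T w) (\<lambda>\<eta>. of_bool (\<eta> w = 1)) \<sigma>"
  shows "E (T w) f \<sigma> = m * \<Phi> 1 + (1 - m) * \<Phi> (-1)"
proof -
  have "E (T w) f \<sigma> = E (T w) (E (T w - {w}) f) \<sigma>" using \<sigma> by (simp add: E_tower)
  also have "\<dots> = E (T w) (\<lambda>\<zeta>. \<Phi> (-1) * 1 + (\<Phi> 1 - \<Phi> (-1)) * of_bool (\<zeta> w = 1)) \<sigma>"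
    using spin_values[OF fib_in w] by (intro E_cong) (fastforce simp: f)
  also have "\<dots> = \<Phi> (-1) * 1 + (\<Phi> 1 - \<Phi> (-1)) * m"
    unfolding E_add m_def using \<sigma>
    by (subst (1 2) E_ignored_mult) (auto simp: ignores_def E_one)
  finally show ?thesis by (simp add: algebra_simps)
qed

lemma E_of_bool_bounds:
  assumes "\<sigma> \<in> \<Omega>"
  shows "0 \<le> E S (\<lambda>\<eta>. of_bool (Q \<eta>)) \<sigma>" "E S (\<lambda>\<eta>. of_bool (Q \<eta>)) \<sigma> \<le> 1"
  using E_nonneg[of S \<sigma> "\<lambda>\<eta>. of_bool (Q \<eta>)"] E_mono[of S \<sigma> "\<lambda>\<eta>. of_bool (Q \<eta>)" "\<lambda>_. 1"] assms
  by (auto simp: E_one)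

text \<open>The Ising edge is a binary channel in an arbitrary field. Only the edge from
  \<open>w\<close> to \<open>v\<close> couples the subtree to \<open>v\<close>, so the odds of
  \<open>\<eta> w = 1\<close> are \<open>exp (2 * \<beta>) * x / y\<close> or
  \<open>exp (- 2 * \<beta>) * x / y\<close> according to the spin at \<open>v\<close>, and their
  ratio is free of the subtree.\<close>

lemma child_odds:
  assumes v: "v \<in> V" "length v + 1 < h" and i: "i < b" and \<sigma>: "\<sigma> \<in> \<Omega>"
  defines "w \<equiv> v @ [i]"
  defines "m \<equiv> \<lambda>s. E (T w) (\<lambda>\<eta>. of_bool (\<eta> w = 1)) (\<sigma>(v := s))"
  shows "m 1 * (1 - m (-1)) = (exp (2 * \<beta>))\<^sup>2 * (m (-1) * (1 - m 1))"
proof -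
  have w: "w \<in> V" "length w < h" "w \<noteq> []" "butlast w = v" "w \<in> T w" "v \<notin> T w" "w \<noteq> v"
    using v i by (auto simp: w_def T_def tree_V_def)
  define en where "en A \<eta> = \<beta> * (\<Sum>u\<in>A. real_of_int (\<eta> u * \<eta> (butlast u)))" for A and \<eta> :: config
  define out where "out = V - {[]} - T w"
  \<comment> \<open>Partition function of the subtree with spin \<open>s\<close> at
    \<open>w\<close>, without the edge to the parent; this omission makes it independent of the spin
    at \<open>v\<close>.\<close>
  define Z where "Z s \<zeta> = (\<Sum>\<eta>\<in>fib (T w) \<zeta>. of_bool (\<eta> w = s) * exp (en (T w - {w}) \<eta>))" for s \<zeta>
  have weight: "ising_weight b h \<beta> \<eta> = exp (\<beta> * (\<eta> w * \<eta> v)) * exp (en (T w - {w}) \<eta>) * exp (en out \<eta>)" for \<eta>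
  proof -
    have split: "V - {[]} = insert w (T w - {w}) \<union> out" using w by (auto simp: out_def T_def)
    have fin: "finite (T w)" "finite out" by (auto simp: T_def out_def finite_tree_V)
    have "sum F (V - {[]}) = sum F (insert w (T w - {w})) + sum F out" for F :: "vertex \<Rightarrow> real"
      unfolding split using fin w by (intro sum.union_disjoint) (auto simp: out_def)
    then have "sum F (V - {[]}) = F w + sum F (T w - {w}) + sum F out" for F :: "vertex \<Rightarrow> real"
      using fin by (simp add: sum.insert_remove)
    then have "ising_energy b h \<eta> = \<eta> w * \<eta> v + (\<Sum>u\<in>T w - {w}. real_of_int (\<eta> u * \<eta> (butlast u)))
        + (\<Sum>u\<in>out. real_of_int (\<eta> u * \<eta> (butlast u)))"
      unfolding ising_energy_def using w by simp
    then show ?thesis by (simp add: ising_weight_def en_def exp_add distrib_left)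
  qed
  have out: "en out \<eta> = en out \<zeta>" if "\<eta> \<in> fib (T w) \<zeta>" for \<eta> \<zeta>
    unfolding en_def
  proof (intro arg_cong[where f = "(*) \<beta>"] sum.cong refl)
    fix u assume u: "u \<in> out"
    have "butlast u \<notin> T w"
    proof
      assume "butlast u \<in> T w"
      then obtain y where "butlast u = w @ y" by (auto simp: T_def)
      moreover have "u \<noteq> []" using u by (auto simp: out_def)
      ultimately have "u = w @ (y @ [last u])" using append_butlast_last_id[of u] by simp
      then show False using u unfolding out_def T_def by blast
    qed
    then have "\<eta> u = \<zeta> u" "\<eta> (butlast u) = \<zeta> (butlast u)"
      using that u by (auto simp: fib_def out_def)
    then show "real_of_int (\<eta> u * \<eta> (butlast u)) = real_of_int (\<zeta> u * \<zeta> (butlast u))" by simp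
  qed
  have ignT: "ignores {v} (\<lambda>\<eta>. of_bool (\<eta> w = s) * exp (en (T w - {w}) \<eta>))" for s
    unfolding ignores_def
  proof (intro ballI)
    fix \<zeta> \<eta> assume \<eta>: "\<eta> \<in> fib {v} \<zeta>"
    have "en (T w - {w}) \<eta> = en (T w - {w}) \<zeta>"
      unfolding en_def
    proof (intro arg_cong[where f = "(*) \<beta>"] sum.cong refl)
      fix u assume u: "u \<in> T w - {w}"
      then obtain x where x: "u = w @ x" "x \<noteq> []" by (auto simp: T_def)
      then have "butlast u = w @ butlast x" by (simp add: butlast_append)
      then have "u \<noteq> v" "butlast u \<noteq> v" using x by (auto simp: w_def)
      then show "real_of_int (\<eta> u * \<eta> (butlast u)) = real_of_int (\<zeta> u * \<zeta> (butlast u))"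
        using \<eta> by (simp add: fib_def)
    qed
    then show "of_bool (\<eta> w = s) * exp (en (T w - {w}) \<eta>) = of_bool (\<zeta> w = s) * exp (en (T w - {w}) \<zeta>)"
      using \<eta> w by (simp add: fib_def)
  qed
  let ?p = "\<sigma>(v := 1)" and ?n = "\<sigma>(v := -1)"
  have pn: "?p \<in> \<Omega>" "?n \<in> \<Omega>" using upd_in[OF \<sigma> v(1)] v(2) by auto
  have Z_eq: "Z s ?n = Z s ?p" for s
    unfolding Z_def using w pn by (intro sum_fib_transport[OF _ ignT]) (auto simp: fib_def)
  have mean: "(\<Sum>\<eta>\<in>fib (T w) \<zeta>. ising_weight b h \<beta> \<eta> * of_bool (\<eta> w = s)) =
      exp (en out \<zeta>) * (exp (\<beta> * (s * \<zeta> v)) * Z s \<zeta>)" if "\<zeta> \<in> \<Omega>" for s \<zeta>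
    unfolding Z_def sum_distrib_left
  proof (intro sum.cong refl)
    fix \<eta> assume \<eta>: "\<eta> \<in> fib (T w) \<zeta>"
    then have "\<eta> v = \<zeta> v" using w by (auto simp: fib_def)
    then show "ising_weight b h \<beta> \<eta> * of_bool (\<eta> w = s) =
      exp (en out \<zeta>) * (exp (\<beta> * (s * \<zeta> v)) * (of_bool (\<eta> w = s) * exp (en (T w - {w}) \<eta>)))"
      by (simp add: weight out[OF \<eta>])
  qed
  have m_eq: "E (T w) (\<lambda>\<eta>. of_bool (\<eta> w = 1)) \<zeta> = exp (\<beta> * \<zeta> v) * Z 1 \<zeta> /
      (exp (\<beta> * \<zeta> v) * Z 1 \<zeta> + exp (- \<beta> * \<zeta> v) * Z (-1) \<zeta>)" if \<zeta>: "\<zeta> \<in> \<Omega>" for \<zeta>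
  proof -
    have "mass (T w) \<zeta> = (\<Sum>\<eta>\<in>fib (T w) \<zeta>. ising_weight b h \<beta> \<eta> * of_bool (\<eta> w = 1)
        + ising_weight b h \<beta> \<eta> * of_bool (\<eta> w = -1))"
      unfolding mass_def using spin_values[OF fib_in w(1)] by (intro sum.cong refl) fastforce
    also have "\<dots> = exp (en out \<zeta>) * (exp (\<beta> * \<zeta> v) * Z 1 \<zeta> + exp (- \<beta> * \<zeta> v) * Z (-1) \<zeta>)"
      unfolding sum.distrib mean[OF \<zeta>] by (simp add: distrib_left)
    finally have mass: "mass (T w) \<zeta> = \<dots>" .
    show ?thesis unfolding E_def mean[OF \<zeta>] mass by simp
  qed
  have Z_pos: "0 < Z s ?p" if "s = 1 \<or> s = -1" for s
    unfolding Z_def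
  proof (rule sum_pos2)
    show "?p(w := s) \<in> fib (T w) ?p"
      using w pn that by (auto simp: fib_def intro!: upd_in)
  qed auto
  define a where "a = exp \<beta>"
  have a: "0 < a" "exp (- \<beta>) = 1 / a" "exp (2 * \<beta>) = a\<^sup>2"
    by (simp_all add: a_def exp_minus exp_double divide_inverse)
  define x y where "x = Z 1 ?p" and "y = Z (-1) ?p"
  have xy: "0 < x" "0 < y" by (auto simp: x_def y_def Z_pos)
  have m1: "m 1 = a * x / (a * x + 1 / a * y)"
    unfolding m_def m_eq[OF pn(1)] using w by (simp add: x_def y_def a flip: a_def)
  have m2: "m (-1) = 1 / a * x / (1 / a * x + a * y)"
    unfolding m_def m_eq[OF pn(2)] using w by (simp add: x_def y_def a Z_eq flip: a_def)
  define d1 d2 where "d1 = a * x + 1 / a * y" and "d2 = 1 / a * x + a * y"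
  have d: "d1 \<noteq> 0" "d2 \<noteq> 0" using xy a by (auto simp: d1_def d2_def add_pos_pos intro!: less_imp_neq[symmetric])
  have "1 - m 1 = 1 / a * y / d1" "1 - m (-1) = a * y / d2"
    unfolding m1 m2 d1_def[symmetric] d2_def[symmetric] using d
    by (simp_all add: field_simps) (simp_all add: d1_def d2_def field_simps)
  then show ?thesis
    unfolding m1 m2 d1_def[symmetric] d2_def[symmetric] a(3) using d a(1)
    by (simp add: power2_eq_square mult_ac)
qed

section \<open>The affinity recursion from children to parent\<close>

lemma Obs_T_children:
  assumes "length v < r"
  shows "Obs \<inter> T v = (\<Union>i<b. Obs \<inter> T (v @ [i]))"
proof -
  have "Obs \<inter> T v = Obs \<inter> (T v - {v})" using assms by (auto simp: Obs_def)
  also have "\<dots> = Obs \<inter> (\<Union>i<b. T (v @ [i]))" using assms r by (simp add: T_children)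
  finally show ?thesis by (simp only: Int_UN_distrib)
qed

lemma ind_children:
  assumes "length v < r"
  shows "ind v y \<eta> = (\<Prod>i<b. ind (v @ [i]) y \<eta>)"
proof -
  have "(\<forall>u\<in>Obs \<inter> T v. \<eta> u = y u) \<longleftrightarrow> (\<forall>i\<in>{..<b}. \<forall>u\<in>Obs \<inter> T (v @ [i]). \<eta> u = y u)"
    unfolding Obs_T_children[OF assms] by (rule ball_UN)
  moreover have "(of_bool (\<forall>i\<in>{..<b}. Q i) :: real) = (\<Prod>i<b. of_bool (Q i))" for Q
    by (induction b) (auto simp: lessThan_Suc)
  ultimately show ?thesis by (simp only: ind_def)
qed

text \<open>Given the spin at \<open>v\<close> the subtrees of its children are independent, and
  \<open>v\<close> itself is not observed, so the indicator and its expectation factor.\<close>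

lemma lik_children:
  assumes v: "v \<in> V" "length v < r" and y: "y \<in> \<Omega>" and s: "s = 1 \<or> s = -1"
  shows "lik v s y = (\<Prod>i<b. E (T (v @ [i])) (ind (v @ [i]) y) (y(v := s)))"
proof -
  have "lik v s y = E (\<Union>i<b. T (v @ [i])) (\<lambda>\<eta>. \<Prod>i<b. ind (v @ [i]) y \<eta>) (y(v := s))"
  proof -
    have "ind v y = (\<lambda>\<eta>. \<Prod>i<b. ind (v @ [i]) y \<eta>)" using ind_children[OF v(2)] by (rule ext)
    then show ?thesis unfolding lik_def using v r by (simp add: T_children)
  qed
  also have "\<dots> = (\<Prod>i<b. E (T (v @ [i])) (ind (v @ [i]) y) (y(v := s)))"
  proof (rule E_UN_prod)
    show "y(v := s) \<in> \<Omega>" using v r y s by (intro upd_in) auto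
    fix i j :: nat assume "i \<noteq> j"
    then have sep: "sep (T (v @ [i])) (T (v @ [j]))" by (intro sep_T) auto
    moreover from sep have "ignores (T (v @ [j])) (ind (v @ [i]) y)"
      by (intro ignores_ind) (auto simp: sep_def)
    ultimately show "sep (T (v @ [i])) (T (v @ [j])) \<and> ignores (T (v @ [j])) (ind (v @ [i]) y)" ..
  qed simp
  finally show ?thesis .
qed

text \<open>Seen from the parent \<open>v\<close>, the law of the observation below \<open>w\<close>
  is a mixture of the two likelihoods at \<open>w\<close>. The mixing weights satisfy
  \<open>child_odds\<close>, so \<open>affinity_mixture\<close> applies with
  \<open>k = exp (2 * \<beta>)\<close>.\<close>

lemma aff_child:
  assumes v: "v \<in> V" "length v + 1 < r" and i: "i < b" and \<sigma>: "\<sigma> \<in> \<Omega>"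
  defines "w \<equiv> v @ [i]"
  shows "1 - (tanh \<beta>)\<^sup>2 * (1 - aff w \<sigma>) \<le> (\<Sum>y\<in>fib (Obs \<inter> T w) \<sigma>.
    sqrt (E (T w) (ind w y) (y(v := 1)) * E (T w) (ind w y) (y(v := -1))))"
proof -
  have w: "w \<in> V" "length w < r" "length w < h"
    using child_in[OF v(1) _ i] v r by (auto simp: w_def)
  have vT: "v \<notin> T w" by (auto simp: w_def T_def)
  have pn: "\<sigma>(v := s) \<in> \<Omega>" if "s = 1 \<or> s = -1" for s
    using upd_in[OF \<sigma> v(1) _ that] v(2) r by auto
  define m where "m s = E (T w) (\<lambda>\<eta>. of_bool (\<eta> w = 1)) (\<sigma>(v := s))" for s
  have mix: "E (T w) (ind w y) (y(v := s)) = m s * lik w 1 y + (1 - m s) * lik w (-1) y"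
    if y: "y \<in> fib (Obs \<inter> T w) \<sigma>" and s: "s = 1 \<or> s = -1" for y s
  proof -
    have "y(v := s) \<in> \<Omega>" using upd_in[OF fib_in[OF y] v(1) _ s] v(2) r by auto
    then have "y(v := s) \<in> fib (T w) (\<sigma>(v := s))"
      using y vT by (auto simp: fib_def)
    \<comment> \<open>\<open>y\<close> differs from \<open>\<sigma>\<close> only inside
      \<open>T w\<close>, so the base point can be changed to \<open>\<sigma>\<close> and the mixing
      weight does not depend on \<open>y\<close>.\<close>
    then have "E (T w) (ind w y) (y(v := s)) = E (T w) (ind w y) (\<sigma>(v := s))" by (rule E_fib)
    also have "\<dots> = m s * lik w 1 y + (1 - m s) * lik w (-1) y"
      unfolding m_def
      by (rule E_T_split[OF w(1) pn[OF s]]) (rule lik_eq[OF fib_in[OF y] fib_in w(1,3)])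
    finally show ?thesis .
  qed
  have "1 - (tanh \<beta>)\<^sup>2 * (1 - aff w \<sigma>) \<le> (\<Sum>y\<in>fib (Obs \<inter> T w) \<sigma>.
      sqrt ((m 1 * lik w 1 y + (1 - m 1) * lik w (-1) y) * (m (-1) * lik w 1 y + (1 - m (-1)) * lik w (-1) y)))"
    unfolding aff_def tanh_exp_double
  proof (rule affinity_mixture)
    show "m 1 * (1 - m (- 1)) = (exp (2 * \<beta>))\<^sup>2 * (m (- 1) * (1 - m 1))"
      unfolding m_def w_def using v r by (intro child_odds i \<sigma>) auto
    show "0 \<le> m 1" "m 1 \<le> 1" "0 \<le> m (-1)" "m (-1) \<le> 1"
      unfolding m_def using pn by (auto intro!: E_of_bool_bounds)
  qed (use sum_lik[OF w(1,2) \<sigma>] \<beta> in \<open>auto simp: lik_nonneg\<close>)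
  also have "\<dots> = (\<Sum>y\<in>fib (Obs \<inter> T w) \<sigma>.
      sqrt (E (T w) (ind w y) (y(v := 1)) * E (T w) (ind w y) (y(v := -1))))"
    by (intro sum.cong refl) (simp add: mix)
  finally show ?thesis .
qed

text \<open>Affinities multiply over the children, and each factor is at least
  \<open>1 - d / b\<close>. At criticality the factor \<open>1 / b\<close> per edge exactly offsets
  the branching, so the linear term is preserved and the quadratic loss \<open>d^2 / 4\<close>
  drives the decay.\<close>

lemma aff_step:
  assumes v: "v \<in> V" "length v + 1 < r" and \<sigma>: "\<sigma> \<in> \<Omega>"
    and th: "(tanh \<beta>)\<^sup>2 = 1 / b"
    and d: "\<And>i. i < b \<Longrightarrow> 1 - aff (v @ [i]) \<sigma> \<le> d" "0 \<le> d" "d \<le> 1"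
  shows "1 - aff v \<sigma> \<le> d - d\<^sup>2 / 4"
proof -
  define F where "F i y = sqrt (E (T (v @ [i])) (ind (v @ [i]) y) (y(v := 1)) *
    E (T (v @ [i])) (ind (v @ [i]) y) (y(v := -1)))" for i y
  have Obs: "Obs \<inter> T v = (\<Union>i<b. Obs \<inter> T (v @ [i]))"
    using v by (intro Obs_T_children) simp
  have "aff v \<sigma> = (\<Sum>y\<in>fib (Obs \<inter> T v) \<sigma>. \<Prod>i<b. F i y)"
    unfolding aff_def F_def using v
    by (intro sum.cong refl) (simp add: lik_children fib_in sqrt_prod_mult)
  also have "\<dots> = (\<Prod>i<b. \<Sum>y\<in>fib (Obs \<inter> T (v @ [i])) \<sigma>. F i y)"
    unfolding Obs
  proof (rule sum_fib_UN)
    fix i j :: nat assume "i \<noteq> j"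
    then have sep: "sep (T (v @ [i])) (T (v @ [j]))" by (intro sep_T) auto
    \<comment> \<open>Changing spins below another child alters neither the event below child
      \<open>i\<close> nor, by separation, its conditional expectation.\<close>
    have "F i \<eta> = F i \<zeta>" if \<zeta>: "\<zeta> \<in> \<Omega>" and \<eta>: "\<eta> \<in> fib (Obs \<inter> T (v @ [j])) \<zeta>" for \<eta> \<zeta>
    proof -
      have ind: "ind (v @ [i]) \<eta> = ind (v @ [i]) \<zeta>"
      proof
        fix \<xi>
        have "\<eta> u = \<zeta> u" if "u \<in> Obs \<inter> T (v @ [i])" for u
          using \<eta> sep that by (auto simp: fib_def sep_def)
        then show "ind (v @ [i]) \<eta> \<xi> = ind (v @ [i]) \<zeta> \<xi>" by (simp add: ind_def)
      qed
      have "E (T (v @ [i])) (ind (v @ [i]) \<zeta>) (\<eta>(v := s)) = E (T (v @ [i])) (ind (v @ [i]) \<zeta>) (\<zeta>(v := s))"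
        if s: "s = 1 \<or> s = -1" for s
      proof (rule ignoresD[OF ignores_E[OF sep]])
        show "ignores (T (v @ [j])) (ind (v @ [i]) \<zeta>)"
          using sep by (intro ignores_ind) (auto simp: sep_def)
        show "\<zeta>(v := s) \<in> \<Omega>" using upd_in[OF \<zeta> v(1) _ s] v(2) r by auto
        have "\<eta>(v := s) \<in> \<Omega>" using upd_in[OF fib_in[OF \<eta>] v(1) _ s] v(2) r by auto
        then show "\<eta>(v := s) \<in> fib (T (v @ [j])) (\<zeta>(v := s))"
          using \<eta> by (auto simp: fib_def)
      qed
      then show ?thesis by (simp add: F_def ind)
    qed
    then show "Obs \<inter> T (v @ [i]) \<inter> (Obs \<inter> T (v @ [j])) = {} \<and> ignores (Obs \<inter> T (v @ [j])) (F i)"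
      using sep by (auto simp: ignores_def sep_def)
  qed (use \<sigma> in auto)
  also have "\<dots> \<ge> (\<Prod>i\<in>{..<b}. 1 - d / real b)"
  proof (rule prod_mono, safe)
    fix i assume "i < b"
    have "d / b \<le> 1" using d(3) b by (simp add: divide_simps)
    then show "0 \<le> 1 - d / b" by simp
    have "1 - d / b \<le> 1 - (tanh \<beta>)\<^sup>2 * (1 - aff (v @ [i]) \<sigma>)"
      using d(1)[OF \<open>i < b\<close>] b by (simp add: th divide_right_mono)
    also have "\<dots> \<le> (\<Sum>y\<in>fib (Obs \<inter> T (v @ [i])) \<sigma>. F i y)"
      unfolding F_def using aff_child[OF v \<open>i < b\<close> \<sigma>] .
    finally show "1 - d / b \<le> (\<Sum>y\<in>fib (Obs \<inter> T (v @ [i])) \<sigma>. F i y)" .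
  qed
  finally have "(1 - d / b) ^ b \<le> aff v \<sigma>" by simp
  moreover have "(1 - b * (d / b) / 2)\<^sup>2 \<le> (1 - d / b) ^ b"
    using d(2,3) b by (intro one_minus_power_ge_square) auto
  moreover have "b * (d / b) = d" using b by simp
  ultimately show ?thesis by (simp add: power2_eq_square algebra_simps)
qed

text \<open>\<open>n + 1\<close> is the distance from \<open>v\<close> to the first observed level.
  The bound starts at the trivial value 1 and is stable under \<open>d - d^2 / 4\<close> because
  \<open>(n + 3) * (n + 5) \<le> (n + 4)^2\<close>.\<close>

lemma aff_bound:
  assumes th: "(tanh \<beta>)\<^sup>2 = 1 / b" and \<sigma>: "\<sigma> \<in> \<Omega>"
    and "v \<in> V" "length v + n + 1 = r"
  shows "1 - aff v \<sigma> \<le> 4 / (real n + 4)"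
  using assms(3,4)
proof (induction n arbitrary: v)
  case 0
  have "0 \<le> aff v \<sigma>" unfolding aff_def by (intro sum_nonneg) (simp add: lik_nonneg)
  then show ?case by simp
next
  case (Suc n)
  define d where "d = 4 / (real n + 4)"
  have "1 - aff v \<sigma> \<le> d - d\<^sup>2 / 4"
  proof (rule aff_step[OF _ _ \<sigma> th])
    show "1 - aff (v @ [i]) \<sigma> \<le> d" if "i < b" for i
      unfolding d_def using Suc.prems r that by (intro Suc.IH child_in) auto
  qed (use Suc.prems in \<open>auto simp: d_def\<close>)
  also have "\<dots> \<le> 4 / (real (Suc n) + 4)"
  proof -
    have "d - d\<^sup>2 / 4 = 4 * (real n + 3) / (real n + 4)\<^sup>2"
      unfolding d_def by (simp add: divide_simps power2_eq_square)
    also have "\<dots> \<le> 4 / (real (Suc n) + 4)"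
      by (simp add: divide_simps power2_eq_square; simp add: algebra_simps)
    finally show ?thesis .
  qed
  finally show ?case .
qed

text \<open>\<open>two_point_variance\<close> on each fibre of \<open>T v\<close>, with the spin at
  \<open>v\<close> as the hidden bit, averaged over the spins outside. These spins determine the
  prior, so a bound uniform in the prior is essential.\<close>

lemma single_site:
  assumes v: "v \<in> V" "length v < r" and c: "\<And>\<sigma>. \<sigma> \<in> \<Omega> \<Longrightarrow> 2 * (1 - aff v \<sigma>) \<le> c"
    and g: "ignores (T v - Obs) g"
  shows "nrm2 (E (T v - {v}) g) \<le> c * nrm2 g + (1 - c) * nrm2 (E (T v) g)"
proof -
  let ?L = "E (T v - {v}) g"
  have pw: "E (T v) (\<lambda>\<eta>. (?L \<eta>)\<^sup>2) \<sigma> \<le> c * E (T v) (\<lambda>\<eta>. (g \<eta>)\<^sup>2) \<sigma> + (1 - c) * (E (T v) g \<sigma>)\<^sup>2"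
    if \<sigma>: "\<sigma> \<in> \<Omega>" for \<sigma>
  proof -
    define m where "m = E (T v) (\<lambda>\<eta>. of_bool (\<eta> v = 1)) \<sigma>"
    define Y where "Y = fib (Obs \<inter> T v) \<sigma>"
    define A where "A f s = (\<Sum>y\<in>Y. lik v s y * f y)" for f s
    have L: "E (T v - {v}) f \<zeta> = A f (\<zeta> v)" if "ignores (T v - Obs) f" "\<zeta> \<in> fib (T v) \<sigma>" for f \<zeta>
      unfolding A_def Y_def by (rule E_given_obs[OF v that(1) \<sigma> that(2)])
    have g2: "ignores (T v - Obs) (\<lambda>\<eta>. (g \<eta>)\<^sup>2)" using g by (auto simp: ignores_def)
    have "E (T v - {v}) (\<lambda>\<eta>. (?L \<eta>)\<^sup>2) \<zeta> = (A g (\<zeta> v))\<^sup>2" if "\<zeta> \<in> fib (T v) \<sigma>" for \<zeta>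
    proof -
      have "ignores (T v - {v}) (\<lambda>\<eta>. (?L \<eta>)\<^sup>2)"
        using E_ignores[of "T v - {v}" g] by (auto simp: ignores_def)
      then show ?thesis using L[OF g that] by (simp add: E_ignored fib_in[OF that])
    qed
    then have "E (T v) (\<lambda>\<eta>. (?L \<eta>)\<^sup>2) \<sigma> = m * (A g 1)\<^sup>2 + (1 - m) * (A g (-1))\<^sup>2"
      unfolding m_def by (intro E_T_split[OF v(1) \<sigma>])
    moreover have "E (T v) g \<sigma> = m * A g 1 + (1 - m) * A g (-1)"
      unfolding m_def by (intro E_T_split[OF v(1) \<sigma>] L g)
    moreover have "E (T v) (\<lambda>\<eta>. (g \<eta>)\<^sup>2) \<sigma> = m * A (\<lambda>\<eta>. (g \<eta>)\<^sup>2) 1 + (1 - m) * A (\<lambda>\<eta>. (g \<eta>)\<^sup>2) (-1)"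
      unfolding m_def by (intro E_T_split[OF v(1) \<sigma>] L g2)
    moreover have "m * (A g 1)\<^sup>2 + (1 - m) * (A g (-1))\<^sup>2 \<le>
        c * (m * A (\<lambda>\<eta>. (g \<eta>)\<^sup>2) 1 + (1 - m) * A (\<lambda>\<eta>. (g \<eta>)\<^sup>2) (-1)) + (1 - c) * (m * A g 1 + (1 - m) * A g (-1))\<^sup>2"
      unfolding A_def
    proof (rule two_point_variance)
      show "sum (lik v 1) Y = 1" "sum (lik v (-1)) Y = 1"
        unfolding Y_def using sum_lik[OF v \<sigma>] by auto
      then show "(\<Sum>y\<in>Y. (sqrt (lik v 1 y) - sqrt (lik v (- 1) y))\<^sup>2) \<le> c"
        using c[OF \<sigma>] by (subst sum_hellinger) (auto simp: lik_nonneg aff_def Y_def)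
      show "0 \<le> m" "0 \<le> 1 - m" unfolding m_def using E_of_bool_bounds[OF \<sigma>] by auto
    qed (auto simp: Y_def lik_nonneg)
    ultimately show ?thesis by simp
  qed
  have "(\<Sum>\<sigma>\<in>\<Omega>. ising_weight b h \<beta> \<sigma> * E (T v) (\<lambda>\<eta>. (?L \<eta>)\<^sup>2) \<sigma>) \<le>
      (\<Sum>\<sigma>\<in>\<Omega>. ising_weight b h \<beta> \<sigma> * (c * E (T v) (\<lambda>\<eta>. (g \<eta>)\<^sup>2) \<sigma> + (1 - c) * (E (T v) g \<sigma>)\<^sup>2))"
    by (intro sum_mono mult_left_mono pw) (auto simp: ising_weight_pos less_imp_le)
  also have "\<dots> = c * (\<Sum>\<sigma>\<in>\<Omega>. ising_weight b h \<beta> \<sigma> * E (T v) (\<lambda>\<eta>. (g \<eta>)\<^sup>2) \<sigma>)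
      + (1 - c) * (\<Sum>\<sigma>\<in>\<Omega>. ising_weight b h \<beta> \<sigma> * (E (T v) g \<sigma>)\<^sup>2)"
    by (simp add: sum_distrib_left sum.distrib[symmetric] distrib_left mult.left_commute)
  finally show ?thesis unfolding sum_W_E by (simp add: ip_def power2_eq_square mult.assoc)
qed

section \<open>Decay of correlation between top and bottom levels\<close>

definition lev :: "nat \<Rightarrow> vertex set" where
  "lev k = {u \<in> V. k \<le> length u}"

lemma lev_subtrees: "k \<le> h \<Longrightarrow> lev k = (\<Union>v\<in>level b h k. T v)"
proof (intro equalityI subsetI)
  fix u assume "k \<le> h" "u \<in> lev k"
  then have "take k u \<in> level b h k" "u \<in> T (take k u)"
    by (auto simp: lev_def level_def tree_V_def T_def dest: in_set_takeD intro: exI[of _ "drop k u"])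
  then show "u \<in> (\<Union>v\<in>level b h k. T v)" by blast
qed (auto simp: lev_def level_def T_def)

lemma lev_Suc_subtrees: "k \<le> h \<Longrightarrow> lev (Suc k) = (\<Union>v\<in>level b h k. T v - {v})"
proof -
  assume "k \<le> h"
  have "lev (Suc k) = lev k - level b h k" by (auto simp: lev_def level_def)
  also have "\<dots> = (\<Union>v\<in>level b h k. T v - {v})"
    unfolding lev_subtrees[OF \<open>k \<le> h\<close>] by (auto simp: level_def T_def)
  finally show ?thesis .
qed

lemma finite_level: "finite (level b h k)"
  unfolding level_def using finite_tree_V by simp

text \<open>Passing from \<open>lev k\<close> to \<open>lev (Suc k)\<close> reveals level
  \<open>k\<close>, whose subtrees are separated, so by \<open>tensorize\<close> each revealed level
  adds at most \<open>c * nrm2 g\<close>.\<close>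

lemma lev_decay:
  assumes c: "0 \<le> c" "c \<le> 1" "\<And>v \<sigma>. v \<in> V \<Longrightarrow> length v < l \<Longrightarrow> \<sigma> \<in> \<Omega> \<Longrightarrow> 2 * (1 - aff v \<sigma>) \<le> c"
    and l: "l \<le> r" and g: "ignores (- Obs) g"
    and mean: "(\<Sum>\<sigma>\<in>\<Omega>. ising_weight b h \<beta> \<sigma> * g \<sigma>) = 0"
  shows "nrm2 (E (lev l) g) \<le> l * c * nrm2 g"
  using c(3) l
proof (induction l)
  case 0
  have zero: "\<sigma> u = 0" if "\<sigma> \<in> \<Omega>" "u \<notin> V" for \<sigma> u
    using that by (simp add: configs_def)
  \<comment> \<open>With nothing revealed the expectation is the global mean, which
    vanishes.\<close>
  have "fib (lev 0) \<sigma> = \<Omega>" if "\<sigma> \<in> \<Omega>" for \<sigma>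
    using that by (auto simp: fib_def lev_def zero)
  then have "E (lev 0) g \<sigma> = 0" if "\<sigma> \<in> \<Omega>" for \<sigma>
    using that mean by (simp add: E_def)
  then show ?case by (simp add: ip_def)
next
  case (Suc k)
  have k: "k \<le> h" using Suc.prems r by simp
  have "nrm2 (E (\<Union>v\<in>level b h k. T v - {v}) g) \<le> c * nrm2 g + (1 - c) * nrm2 (E (\<Union>v\<in>level b h k. T v) g)"
  proof (rule tensorize[where X = "\<lambda>v. T v - Obs"])
    fix v and f :: "config \<Rightarrow> real" assume v: "v \<in> level b h k" and f: "ignores (T v - Obs) f"
    show "nrm2 (E (T v - {v}) f) \<le> c * nrm2 f + (1 - c) * nrm2 (E (T v) f)"
      using v Suc.prems by (intro single_site f) (auto simp: level_def)
  qed (auto simp: finite_tree_V c level_def intro!: sep_T intro: ignores_mono[OF g])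
  then have "nrm2 (E (lev (Suc k)) g) \<le> c * nrm2 g + (1 - c) * nrm2 (E (lev k) g)"
    by (simp only: lev_subtrees[OF k] lev_Suc_subtrees[OF k])
  \<comment> \<open>Giving up the factor \<open>1 - c\<close> makes the bound additive over
    levels.\<close>
  also have "\<dots> \<le> c * nrm2 g + nrm2 (E (lev k) g)"
    using c(1) nrm2_nonneg[of "E (lev k) g"] by (simp add: mult_left_le_one_le algebra_simps)
  also have "nrm2 (E (lev k) g) \<le> k * c * nrm2 g"
    using Suc by simp
  finally show ?case by (simp add: algebra_simps)
qed

text \<open>Two weakly correlated conditionings control the full variance. \<open>G\<close> depends
  on the observed levels only, so \<open>lev_decay\<close> bounds it by its variance over
  \<open>A\<close>. Writing \<open>G = f - f'\<close>, that variance is at most twice the variance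
  of \<open>f\<close> over \<open>A\<close> plus twice that over \<open>- Obs\<close>. Adding the
  norm of \<open>f'\<close> gives the constants 2 and 3, rounded up to 3.\<close>

lemma poincare:
  assumes c: "0 \<le> c" "c \<le> 1" "\<And>v \<sigma>. v \<in> V \<Longrightarrow> length v < l \<Longrightarrow> \<sigma> \<in> \<Omega> \<Longrightarrow> 2 * (1 - aff v \<sigma>) \<le> c"
    and l: "l \<le> r" and mean: "(\<Sum>\<sigma>\<in>\<Omega>. ising_weight b h \<beta> \<sigma> * f \<sigma>) = 0"
  shows "(1 - l * c) * nrm2 f \<le>
    3 * ((nrm2 f - nrm2 (E (lev l) f)) + (nrm2 f - nrm2 (E (- Obs) f)))"
proof -
  define A where "A = lev l"
  define G where "G = E (- Obs) f"
  define f' where "f' \<sigma> = f \<sigma> - G \<sigma>" for \<sigma>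
  have f': "nrm2 f' = nrm2 f - nrm2 G" unfolding f'_def[abs_def] G_def by (rule nrm2_diff_E)
  have "nrm2 (E A G) \<le> l * c * nrm2 G"
    unfolding A_def
  proof (rule lev_decay[OF c l])
    show "ignores (- Obs) G" unfolding G_def by (rule E_ignores)
    show "(\<Sum>\<sigma>\<in>\<Omega>. ising_weight b h \<beta> \<sigma> * G \<sigma>) = 0" unfolding G_def sum_W_E by (rule mean)
  qed
  then have "(1 - l * c) * nrm2 G \<le> nrm2 G - nrm2 (E A G)" by (simp add: algebra_simps)
  also have "\<dots> = nrm2 (\<lambda>\<sigma>. (f \<sigma> - E A f \<sigma>) - (f' \<sigma> - E A f' \<sigma>))"
    unfolding nrm2_diff_E[symmetric] f'_def[abs_def] E_diff by (intro nrm2_cong) simp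
  also have "\<dots> \<le> 2 * nrm2 (\<lambda>\<sigma>. f \<sigma> - E A f \<sigma>) + 2 * nrm2 (\<lambda>\<sigma>. f' \<sigma> - E A f' \<sigma>)"
    by (rule nrm2_diff_le)
  also have "\<dots> \<le> 2 * (nrm2 f - nrm2 (E A f)) + 2 * (nrm2 f - nrm2 G)"
    unfolding nrm2_diff_E using nrm2_nonneg[of "E A f'"] f' by simp
  finally have "(1 - l * c) * nrm2 G \<le> 2 * (nrm2 f - nrm2 (E A f)) + 2 * (nrm2 f - nrm2 G)" .
  moreover have "(1 - l * c) * (nrm2 f - nrm2 G) \<le> 1 * (nrm2 f - nrm2 G)"
    using c(1) nrm2_nonneg[of f'] f' by (intro mult_right_mono) auto
  moreover have "nrm2 (E A f) \<le> nrm2 f" by (rule nrm2_E_le)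
  ultimately show ?thesis unfolding A_def[symmetric] G_def[symmetric] by (simp add: algebra_simps)
qed

section \<open>Block updates and the eigenvalue equation\<close>

text \<open>Spins at leaves and off the tree are the same in all configurations, so a region matters
  only through its inner vertices.\<close>

lemma fib_cong:
  assumes "\<sigma> \<in> \<Omega>" and "\<And>u. u \<in> V \<Longrightarrow> length u < h \<Longrightarrow> u \<in> S \<longleftrightarrow> u \<in> S'"
  shows "fib S \<sigma> = fib S' \<sigma>"
proof -
  have "\<eta> u = \<sigma> u" if "\<eta> \<in> \<Omega>" "u \<notin> V \<or> \<not> length u < h" for \<eta> u
  proof (cases "u \<in> V")
    case True
    then have "u \<in> level b h h" using that by (auto simp: level_def tree_V_def)
    then show ?thesis using that assms(1) by (simp add: configs_def)
  next
    case False
    then show ?thesis using that assms(1) by (simp add: configs_def)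
  qed
  then have "(\<forall>u. u \<notin> S \<longrightarrow> \<eta> u = \<sigma> u) \<longleftrightarrow> (\<forall>u. u \<notin> S' \<longrightarrow> \<eta> u = \<sigma> u)" if "\<eta> \<in> \<Omega>" for \<eta>
    using that assms(2) by meson
  then show ?thesis unfolding fib_def by blast
qed

lemma E_block:
  assumes "\<sigma> \<in> \<Omega>" "r + length v = h"
  shows "E (block b h v r) f \<sigma> = E (T v) f \<sigma>"
proof -
  have "fib (block b h v r) \<sigma> = fib (T v) \<sigma>"
    using assms by (intro fib_cong) (auto simp: block_def T_def)
  then show ?thesis by (simp add: E_def mass_def)
qed

lemma E_root_block:
  assumes "\<sigma> \<in> \<Omega>"
  shows "E (block b h [] r) f \<sigma> = E (- Obs) f \<sigma>"
proof -
  have "fib (block b h [] r) \<sigma> = fib (- Obs) \<sigma>"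
    using assms by (intro fib_cong) (auto simp: block_def Obs_def)
  then show ?thesis by (simp add: E_def mass_def)
qed

lemma sum_block_update:
  assumes "\<sigma> \<in> \<Omega>"
  shows "(\<Sum>\<eta>\<in>\<Omega>. block_update b h \<beta> \<tau> B \<sigma> \<eta> * f \<eta>) = E B f \<sigma>"
proof -
  define Z where "Z = (\<Sum>\<eta>\<in>\<Omega>. ising_weight b h \<beta> \<eta>)"
  have Z: "0 < Z" unfolding Z_def using assms by (intro sum_pos finite_configs ising_weight_pos) auto
  have "(\<Sum>\<eta>\<in>\<Omega>. block_update b h \<beta> \<tau> B \<sigma> \<eta> * f \<eta>) =
      (\<Sum>\<eta>\<in>\<Omega>. if \<eta> \<in> fib B \<sigma> then gibbs b h \<beta> \<tau> \<eta> / (\<Sum>\<zeta>\<in>fib B \<sigma>. gibbs b h \<beta> \<tau> \<zeta>) * f \<eta> else 0)"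
    by (intro sum.cong refl) (auto simp: block_update_def fib_def)
  also have "\<dots> = (\<Sum>\<eta>\<in>fib B \<sigma>. gibbs b h \<beta> \<tau> \<eta> / (\<Sum>\<zeta>\<in>fib B \<sigma>. gibbs b h \<beta> \<tau> \<zeta>) * f \<eta>)"
    by (rule sum_fib_eq_if[symmetric])
  also have "\<dots> = (\<Sum>\<eta>\<in>fib B \<sigma>. ising_weight b h \<beta> \<eta> * f \<eta> / mass B \<sigma>)"
  proof (intro sum.cong refl)
    fix \<eta>
    have "(\<Sum>\<zeta>\<in>fib B \<sigma>. gibbs b h \<beta> \<tau> \<zeta>) = mass B \<sigma> / Z"
      by (simp add: gibbs_def Z_def mass_def sum_divide_distrib)
    then show "gibbs b h \<beta> \<tau> \<eta> / (\<Sum>\<zeta>\<in>fib B \<sigma>. gibbs b h \<beta> \<tau> \<zeta>) * f \<eta> =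
        ising_weight b h \<beta> \<eta> * f \<eta> / mass B \<sigma>"
      using Z by (simp add: gibbs_def flip: Z_def)
  qed
  finally show ?thesis by (simp add: E_def sum_divide_distrib)
qed

text \<open>The eigenvalue equation is paired with \<open>f\<close> in \<open>L^2(W)\<close>; each
  block update is a projection and contributes the squared norm of its image. The right side is the
  Dirichlet form times the number of blocks.\<close>

lemma eigenvalue_dirichlet:
  assumes ev: "\<forall>\<sigma>\<in>\<Omega>. (\<Sum>\<eta>\<in>\<Omega>. block_dynamics b h \<beta> \<tau> l r \<sigma> \<eta> * f \<eta>) = c * f \<sigma>"
    and l: "0 < l" "r + l = h"
  shows "(real b ^ l + 1) * (1 - c) * nrm2 f =
    (\<Sum>v\<in>level b h l. nrm2 f - nrm2 (E (T v) f)) + (nrm2 f - nrm2 (E (- Obs) f))"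
proof -
  \<comment> \<open>\<open>0 < l\<close> keeps the root from being counted twice, giving
    \<open>b ^ l + 1\<close> blocks.\<close>
  have root: "[] \<notin> level b h l" using l by (auto simp: level_def)
  define N where "N = real b ^ l + 1"
  have N: "real (card (level b h l \<union> {[]})) = N" "0 < N"
    using root l by (auto simp: finite_level card_level N_def add_nonneg_pos)
  have sum: "(\<Sum>v\<in>level b h l. E (T v) f \<sigma>) + E (- Obs) f \<sigma> = N * c * f \<sigma>" if \<sigma>: "\<sigma> \<in> \<Omega>" for \<sigma>
  proof -
    have "c * f \<sigma> = (\<Sum>v\<in>level b h l \<union> {[]}. E (block b h v r) f \<sigma>) / N"
    proof -
      have "c * f \<sigma> = (\<Sum>\<eta>\<in>\<Omega>. (\<Sum>v\<in>level b h l \<union> {[]}. block_update b h \<beta> \<tau> (block b h v r) \<sigma> \<eta> * f \<eta>)) / N"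
        using ev \<sigma> unfolding block_dynamics_def N(1) by (simp add: sum_distrib_right sum_divide_distrib)
      then show ?thesis
        by (subst (asm) sum.swap) (simp only: sum_block_update[OF \<sigma>])
    qed
    also have "(\<Sum>v\<in>level b h l \<union> {[]}. E (block b h v r) f \<sigma>) =
        (\<Sum>v\<in>level b h l. E (block b h v r) f \<sigma>) + E (block b h [] r) f \<sigma>"
      using root by (simp add: finite_level)
    also have "(\<Sum>v\<in>level b h l. E (block b h v r) f \<sigma>) = (\<Sum>v\<in>level b h l. E (T v) f \<sigma>)"
      using l \<sigma> by (intro sum.cong refl E_block) (auto simp: level_def)
    finally show ?thesis using N(2) by (simp add: E_root_block[OF \<sigma>] field_simps)
  qed
  have "N * c * nrm2 f = ip f (\<lambda>\<sigma>. N * c * f \<sigma>)"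
    unfolding ip_def sum_distrib_left by (intro sum.cong refl) simp
  also have "\<dots> = ip f (\<lambda>\<sigma>. (\<Sum>v\<in>level b h l. E (T v) f \<sigma>) + E (- Obs) f \<sigma>)"
    by (intro ip_cong refl) (simp add: sum)
  also have "\<dots> = (\<Sum>v\<in>level b h l. ip f (E (T v) f)) + ip f (E (- Obs) f)"
    unfolding ip_def distrib_left sum.distrib sum_distrib_left by (subst sum.swap) simp
  finally have "N * c * nrm2 f = (\<Sum>v\<in>level b h l. nrm2 (E (T v) f)) + nrm2 (E (- Obs) f)"
    by (simp only: nrm2_E)
  moreover have "(\<Sum>v\<in>level b h l. nrm2 f) = (N - 1) * nrm2 f"
    using l by (simp add: card_level N_def)
  ultimately show ?thesis
    unfolding N_def[symmetric] sum_subtractf by (simp add: algebra_simps)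
qed

text \<open>\<open>efron_stein\<close> bounds the variance over \<open>lev l\<close> by the subtree
  terms of the Dirichlet form, which then dominates the right side of
  \<open>poincare\<close>.\<close>

lemma eigenvalue_bound:
  assumes c: "c \<in> nontrivial_eigenvalues \<Omega> (gibbs b h \<beta> \<tau>) (block_dynamics b h \<beta> \<tau> l r)"
    and l: "0 < l" "l < r" "r + l = h" and th: "(tanh \<beta>)\<^sup>2 = 1 / b"
  shows "0 \<le> 1 - c"
    and "8 * real l / real (r - l) \<le> 1 \<Longrightarrow> (1 - 8 * real l / real (r - l)) / (3 * (real b ^ l + 1)) \<le> 1 - c"
proof -
  obtain f \<sigma> where \<sigma>: "\<sigma> \<in> \<Omega>" "f \<sigma> \<noteq> 0" and mean: "(\<Sum>\<sigma>\<in>\<Omega>. gibbs b h \<beta> \<tau> \<sigma> * f \<sigma>) = 0"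
    and ev: "\<forall>\<sigma>\<in>\<Omega>. (\<Sum>\<eta>\<in>\<Omega>. block_dynamics b h \<beta> \<tau> l r \<sigma> \<eta> * f \<eta>) = c * f \<sigma>"
    using c unfolding nontrivial_eigenvalues_def by blast
  define N where "N = real b ^ l + 1"
  have N: "0 < N" by (simp add: N_def add_nonneg_pos)
  have f: "0 < nrm2 f" using \<sigma> by (rule nrm2_pos)
  have "(\<Sum>\<sigma>\<in>\<Omega>. ising_weight b h \<beta> \<sigma> * f \<sigma>) / (\<Sum>\<eta>\<in>\<Omega>. ising_weight b h \<beta> \<eta>) = 0"
    using mean by (simp add: gibbs_def sum_divide_distrib)
  moreover have "0 < (\<Sum>\<eta>\<in>\<Omega>. ising_weight b h \<beta> \<eta>)"
    using \<sigma> by (intro sum_pos finite_configs ising_weight_pos) auto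
  ultimately have mean': "(\<Sum>\<sigma>\<in>\<Omega>. ising_weight b h \<beta> \<sigma> * f \<sigma>) = 0" by simp
  have D: "N * (1 - c) * nrm2 f = (\<Sum>v\<in>level b h l. nrm2 f - nrm2 (E (T v) f)) + (nrm2 f - nrm2 (E (- Obs) f))"
    unfolding N_def by (rule eigenvalue_dirichlet[OF ev l(1,3)])
  have "0 \<le> N * (1 - c) * nrm2 f"
    unfolding D by (intro add_nonneg_nonneg sum_nonneg) (simp_all add: nrm2_E_le)
  then show "0 \<le> 1 - c" using N f by (simp add: zero_le_mult_iff)
  assume small: "8 * real l / real (r - l) \<le> 1"
  \<comment> \<open>A vertex at depth less than \<open>l\<close> has \<open>n \<ge> r - l\<close> in
    \<open>aff_bound\<close>, and twice \<open>4 / (n + 4)\<close> is then at most this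
    value.\<close>
  define d where "d = 8 / real (r - l)"
  have ld: "l * d = 8 * real l / real (r - l)" by (simp add: d_def)
  have "d \<le> l * d" using l by (simp add: d_def divide_right_mono)
  have "(1 - l * d) * nrm2 f \<le> 3 * ((nrm2 f - nrm2 (E (lev l) f)) + (nrm2 f - nrm2 (E (- Obs) f)))"
  proof (rule poincare)
    show "0 \<le> d" by (simp add: d_def)
    show "d \<le> 1" using \<open>d \<le> l * d\<close> small[folded ld] by (rule order_trans)
    fix v \<zeta> assume v: "v \<in> V" "length v < l" and \<zeta>: "\<zeta> \<in> \<Omega>"
    define n where "n = r - 1 - length v"
    have "1 - aff v \<zeta> \<le> 4 / (real n + 4)"
      using v l by (intro aff_bound[OF th \<zeta>]) (auto simp: n_def)
    also have "\<dots> \<le> 4 / real (r - l)"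
      using v l by (intro divide_left_mono) (auto simp: n_def)
    finally show "2 * (1 - aff v \<zeta>) \<le> d" by (simp add: d_def)
  qed (use l mean' in auto)
  also have "nrm2 f - nrm2 (E (lev l) f) \<le> (\<Sum>v\<in>level b h l. nrm2 f - nrm2 (E (T v) f))"
    using l unfolding lev_subtrees[of l, OF order.trans[OF less_imp_le[OF l(2)] r]]
    by (intro efron_stein finite_level sep_T) (auto simp: level_def)
  finally have "(1 - l * d) * nrm2 f \<le> 3 * (N * (1 - c) * nrm2 f)" unfolding D by simp
  then have "(1 - l * d) * nrm2 f \<le> (3 * N * (1 - c)) * nrm2 f" by (simp add: mult.assoc)
  then have "1 - l * d \<le> 3 * N * (1 - c)" using f by (simp add: mult_le_cancel_right)
  then show "(1 - 8 * real l / real (r - l)) / (3 * (real b ^ l + 1)) \<le> 1 - c"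
    using N unfolding ld N_def[symmetric] by (simp add: pos_divide_le_eq mult.commute)
qed

text \<open>
  The supremum in the definition of the gap is meaningful only for a nonempty set of eigenvalues. The product of
  all free spins, divided by the weight, is annihilated by every block update.
\<close>

lemma nontrivial_eigenvalue_zero:
  assumes \<tau>: "\<forall>v\<in>level b h h. \<tau> v \<in> {-1, 1}" and r0: "0 < r" and l: "r + l = h"
  shows "0 \<in> nontrivial_eigenvalues \<Omega> (gibbs b h \<beta> \<tau>) (block_dynamics b h \<beta> \<tau> l r)"
proof -
  define I where "I = {u \<in> V. length u < h}"
  have finI: "finite I" by (simp add: I_def finite_tree_V)
  define \<chi> where "\<chi> \<sigma> = (\<Prod>u\<in>I. real_of_int (\<sigma> u))" for \<sigma> :: config
  define f where "f \<sigma> = \<chi> \<sigma> / ising_weight b h \<beta> \<sigma>" for \<sigma>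
  have wf: "ising_weight b h \<beta> \<sigma> * f \<sigma> = \<chi> \<sigma>" for \<sigma>
    using ising_weight_pos[of b h \<beta> \<sigma>] by (simp add: f_def)
  have flip: "(\<Sum>\<eta>\<in>fib S \<sigma>. \<chi> \<eta>) = 0" if v: "v \<in> I" "v \<in> S" for v S \<sigma>
  proof -
    \<comment> \<open>Flipping the spin at \<open>v\<close> is an involution of the fibre that
      changes the sign of \<open>\<chi>\<close>.\<close>
    have "(\<Sum>\<eta>\<in>fib S \<sigma>. \<chi> \<eta>) = (\<Sum>\<eta>\<in>fib S \<sigma>. - \<chi> \<eta>)"
    proof (rule sum.reindex_bij_witness[where i = "\<lambda>\<eta>. \<eta>(v := - \<eta> v)" and j = "\<lambda>\<eta>. \<eta>(v := - \<eta> v)"])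
      fix \<eta> assume \<eta>: "\<eta> \<in> fib S \<sigma>"
      have "\<eta>(v := - \<eta> v) \<in> \<Omega>"
        using spin_values[OF fib_in[OF \<eta>], of v] v by (intro upd_in fib_in[OF \<eta>]) (auto simp: I_def)
      then show "\<eta>(v := - \<eta> v) \<in> fib S \<sigma>" using \<eta> v by (auto simp: fib_def)
      then show "\<eta>(v := - \<eta> v) \<in> fib S \<sigma>" .
      have "(\<Prod>u\<in>I - {v}. real_of_int ((\<eta>(v := - \<eta> v)) u)) = (\<Prod>u\<in>I - {v}. real_of_int (\<eta> u))"
        by (intro prod.cong) auto
      then show "- \<chi> (\<eta>(v := - \<eta> v)) = \<chi> \<eta>"
        unfolding \<chi>_def using prod.remove[OF finI v(1)] by (metis (no_types, lifting) fun_upd_same minus_mult_left minus_minus of_int_minus)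
    qed auto
    then show ?thesis by (simp add: sum_negf)
  qed
  have "(\<Sum>\<eta>\<in>\<Omega>. block_dynamics b h \<beta> \<tau> l r \<sigma> \<eta> * f \<eta>) = 0" if \<sigma>: "\<sigma> \<in> \<Omega>" for \<sigma>
  proof -
    have "E (block b h v r) f \<sigma> = 0" if "v \<in> level b h l \<union> {[]}" for v
    proof -
      have "v \<in> I" "v \<in> block b h v r"
        using that l r0 by (auto simp: level_def I_def block_def tree_V_def)
      then show ?thesis unfolding E_def wf by (simp add: flip)
    qed
    moreover have "(\<Sum>\<eta>\<in>\<Omega>. block_dynamics b h \<beta> \<tau> l r \<sigma> \<eta> * f \<eta>) =
        (\<Sum>\<eta>\<in>\<Omega>. \<Sum>v\<in>level b h l \<union> {[]}. block_update b h \<beta> \<tau> (block b h v r) \<sigma> \<eta> * f \<eta>)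
          / real (card (level b h l \<union> {[]}))"
      unfolding block_dynamics_def by (simp add: sum_distrib_right sum_divide_distrib)
    moreover have "(\<Sum>\<eta>\<in>\<Omega>. \<Sum>v\<in>level b h l \<union> {[]}. block_update b h \<beta> \<tau> (block b h v r) \<sigma> \<eta> * f \<eta>) =
        (\<Sum>v\<in>level b h l \<union> {[]}. E (block b h v r) f \<sigma>)"
      by (subst sum.swap) (simp only: sum_block_update[OF \<sigma>])
    ultimately show ?thesis by simp
  qed
  moreover have "(\<Sum>\<sigma>\<in>\<Omega>. gibbs b h \<beta> \<tau> \<sigma> * f \<sigma>) = 0"
  proof -
    have "(\<Sum>\<sigma>\<in>\<Omega>. gibbs b h \<beta> \<tau> \<sigma> * f \<sigma>) = (\<Sum>\<sigma>\<in>\<Omega>. \<chi> \<sigma>) / (\<Sum>\<eta>\<in>\<Omega>. ising_weight b h \<beta> \<eta>)"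
      by (simp add: gibbs_def sum_divide_distrib flip: wf)
    \<comment> \<open>Orthogonality to constants is the same cancellation, on the fibre of
      everything with the root flipped.\<close>
    moreover have "fib UNIV undefined = \<Omega>" by (simp add: fib_def)
    moreover have "[] \<in> I" using l r0 by (simp add: I_def tree_V_def)
    ultimately show ?thesis using flip[of "[]" UNIV undefined] by simp
  qed
  moreover have "\<exists>\<sigma>\<in>\<Omega>. f \<sigma> \<noteq> 0"
  proof
    let ?\<sigma> = "\<lambda>u. if u \<in> V then (if length u = h then \<tau> u else 1) else 0"
    show "?\<sigma> \<in> \<Omega>" using \<tau> by (auto simp: configs_def level_def)
    have "\<chi> ?\<sigma> = 1" unfolding \<chi>_def by (intro prod.neutral) (auto simp: I_def)
    then show "f ?\<sigma> \<noteq> 0" using ising_weight_pos[of b h \<beta> ?\<sigma>] by (simp add: f_def)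
  qed
  ultimately show ?thesis unfolding nontrivial_eigenvalues_def by auto
qed

end

section \<open>The gap bound with explicit constants\<close>

theorem theorem4p1:
  shows "\<exists>\<kappa>::real. \<kappa> > 1/100 \<and>
    (\<forall>(b::nat) (h::nat) (l::nat) (\<alpha>::real) (\<tau>::config).
       b \<ge> 2 \<longrightarrow> 0 < \<alpha> \<longrightarrow> \<alpha> < 1/2 \<longrightarrow> real l = \<alpha> * real h \<longrightarrow> l > 0 \<longrightarrow>
       (\<forall>v \<in> level b h h. \<tau> v \<in> {-1, 1}) \<longrightarrow>
       (let \<theta> = 1 / sqrt (real b); \<beta>c = artanh \<theta>; r = h - l in
        block_gap b h \<beta>c \<tau> l r
          \<ge> 1 / (4 * (real b ^ l + 1)) * (1 - \<alpha> / (\<kappa> * (1 - \<theta>) * (1 - 2 * \<alpha>)))))"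
proof (intro exI[of _ "1/8"] conjI allI impI)
  fix b h l :: nat and \<alpha> :: real and \<tau> :: config
  assume b: "2 \<le> b" and \<alpha>: "0 < \<alpha>" "\<alpha> < 1/2" and l\<alpha>: "real l = \<alpha> * real h" and l: "0 < l"
    and \<tau>: "\<forall>v\<in>level b h h. \<tau> v \<in> {-1, 1}"
  define \<theta> where "\<theta> = 1 / sqrt (real b)"
  define r where "r = h - l"
  define \<beta> where "\<beta> = artanh \<theta>"
  have \<theta>: "0 < \<theta>" "\<theta> < 1" "\<theta>\<^sup>2 = 1 / b"
    using b by (auto simp: \<theta>_def power_divide)
  have h: "0 < h" using l l\<alpha> by (cases h) auto
  have "\<alpha> * real h < 1/2 * real h" using \<alpha> h by (intro mult_strict_right_mono) auto
  then have "2 * l < h" using l\<alpha> by linarith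
  then have lr: "l < r" "r + l = h" "r \<le> h" by (auto simp: r_def)
  have "0 \<le> \<beta>" unfolding \<beta>_def artanh_def using \<theta> by (intro divide_nonneg_pos ln_ge_zero) auto
  then interpret ising_tree b h r \<beta> \<tau> using b lr by unfold_locales auto
  have th: "(tanh \<beta>)\<^sup>2 = 1 / b"
    unfolding \<beta>_def using \<theta> by (simp add: tanh_artanh_real)
  \<comment> \<open>\<open>x\<close> is the subtracted term for \<open>\<kappa> = 1/8\<close>. As
    \<open>r - l = (1 - 2 * \<alpha>) * h\<close>, the correlation bound \<open>\<rho>\<close>
    equals \<open>8 * \<alpha> / (1 - 2 * \<alpha>)\<close>, and dividing it by
    \<open>1 - \<theta> < 1\<close> only weakens the claim.\<close>
  define x where "x = \<alpha> / (1/8 * (1 - \<theta>) * (1 - 2 * \<alpha>))"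
  define \<rho> where "\<rho> = 8 * real l / real (r - l)"
  have "\<alpha> / (1 - 2 * \<alpha>) = real l / real (r - l)"
  proof -
    have "real (r - l) = (1 - 2 * \<alpha>) * real h" using \<open>2 * l < h\<close> l\<alpha> by (simp add: r_def of_nat_diff algebra_simps)
    then show ?thesis using h by (simp add: l\<alpha>)
  qed
  moreover have "x = 8 * (\<alpha> / (1 - 2 * \<alpha>)) / (1 - \<theta>)" by (simp add: x_def mult.commute)
  ultimately have "x = \<rho> / (1 - \<theta>)" by (simp add: \<rho>_def)
  moreover have \<rho>0: "0 \<le> \<rho>" by (simp add: \<rho>_def)
  ultimately have \<rho>: "\<rho> \<le> x" using \<theta> by (simp add: pos_le_divide_eq mult_left_le)
  define N where "N = real b ^ l + 1"
  have N: "0 < N" by (simp add: N_def add_nonneg_pos)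
  have bound: "1 / (4 * N) * (1 - x) \<le> 1 - c"
    if c: "c \<in> nontrivial_eigenvalues \<Omega> (gibbs b h \<beta> \<tau>) (block_dynamics b h \<beta> \<tau> l r)" for c
  \<comment> \<open>If \<open>x > 1\<close> the claimed bound is negative and
    \<open>0 \<le> 1 - c\<close> suffices; otherwise \<open>\<rho> \<le> x \<le> 1\<close>, and 3 in
    the denominator is better than 4.\<close>
  proof (cases "x \<le> 1")
    case True
    have "1 / (4 * N) * (1 - x) \<le> (1 - \<rho>) / (3 * N)"
      using True \<rho> N by (simp add: divide_simps)
    also have "\<dots> \<le> 1 - c"
      unfolding \<rho>_def N_def using True \<rho> by (intro eigenvalue_bound[OF c l lr(1,2) th]) (simp add: \<rho>_def)
    finally show ?thesis .
  next
    case False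
    then have "1 / (4 * N) * (1 - x) \<le> 0" using N by (intro mult_nonneg_nonpos) auto
    also have "0 \<le> 1 - c" by (rule eigenvalue_bound[OF c l lr(1,2) th])
    finally show ?thesis .
  qed
  have "Sup (nontrivial_eigenvalues \<Omega> (gibbs b h \<beta> \<tau>) (block_dynamics b h \<beta> \<tau> l r)) \<le> 1 - 1 / (4 * N) * (1 - x)"
  \<comment> \<open>Bounding the supremum requires a nonempty set, which the eigenvalue 0
    provides.\<close>
  proof (rule cSup_least)
    show "nontrivial_eigenvalues \<Omega> (gibbs b h \<beta> \<tau>) (block_dynamics b h \<beta> \<tau> l r) \<noteq> {}"
      using nontrivial_eigenvalue_zero[OF \<tau> _ lr(2)] lr(1) by auto
  qed (use bound in force)
  then show "let \<theta> = 1 / sqrt (real b); \<beta>c = artanh \<theta>; r = h - l in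
        block_gap b h \<beta>c \<tau> l r
          \<ge> 1 / (4 * (real b ^ l + 1)) * (1 - \<alpha> / (1/8 * (1 - \<theta>) * (1 - 2 * \<alpha>)))"
    unfolding Let_def \<theta>_def[symmetric] \<beta>_def[symmetric] r_def[symmetric] x_def[symmetric] N_def[symmetric]
      block_gap_def spectral_gap_def by simp
qed simp

end
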